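(* Let $1\to R\to F\xrightarrow{\pi} G\to 1$ be a short exact sequence of groups where $G$ is a finite group and $F=\langle f_1\rangle\ast\cdots\ast\langle f_d\rangle$ is a free product of finitely many finite cyclic groups, with $m_i=o(f_i)<\infty$. Put $E=F/[R,F]$. Then $E$, with the induced projection $E\to G$ of kernel $R/[R,F]$, is a finite cover of $G$. Moreover, if $\pi$ preserves the order of the generators, i.e. $o(\pi(f_i))=o(f_i)$ for all $i=1,\dots,d$, then $E$ has minimal exponent among the covers of $G$, i.e. $\exp E\le \exp E'$ for every cover $E'$ of $G$.
   Context: A cover of a finite group $G$ is a finite central extension $1\to A\to E\to G\to 1$ (so $E$ is finite and $[E,A]=1$) satisfying the following equivalent conditions: (i) every projective representation $G\to \mathrm{PGL}_n(\mathbb C)$ lifts to an ordinary representation $E\to \mathrm{GL}_n(\mathbb C)$; (ii) the standard map $\eta:\mathrm{Hom}(A,\mathbb C^\times)\to H^2(G,\mathbb C^\times)$, $\eta(\lambda)=[\lambda\circ\gamma]$, is surjective, where $\gamma\in Z^2(G,A)$ is a cocycle of the extension and $G$ acts trivially on $\mathbb C^\times$; (iii) $[E,E]\cap A\simeq H^2(G,\mathbb C^\times)$. $[R,F]$ is the subgroup generated by the commutators of elements of $R$ with elements of $F$; $o(x)$ denotes the order of $x$ and $\exp$ the exponent of a group. *)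

theory Defs
  imports Complex_Main "HOL-Algebra.Product_Groups" "HOL-Algebra.Multiplicative_Group"
begin

text \<open>The (internal) free product of a family of subgroups, via normal forms: the subgroups
  generate the group, and no nonempty reduced word -- nontrivial syllables, adjacent syllables
  taken from different factors -- represents the identity. A word is a list of pairs consisting
  of the index of a factor and an element of it.\<close>

definition reduced_word ::
  "('a, 'b) monoid_scheme \<Rightarrow> 'i set \<Rightarrow> ('i \<Rightarrow> 'a set) \<Rightarrow> ('i \<times> 'a) list \<Rightarrow> bool" where
  "reduced_word F I H w \<longleftrightarrow>
     (\<forall>(i, h) \<in> set w. i \<in> I \<and> h \<in> H i \<and> h \<noteq> \<one>\<^bsub>F\<^esub>) \<and> distinct_adj (map fst w)"

definition word_value :: "('a, 'b) monoid_scheme \<Rightarrow> ('i \<times> 'a) list \<Rightarrow> 'a" where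
  "word_value F w = foldr (\<lambda>(i, h) x. h \<otimes>\<^bsub>F\<^esub> x) w \<one>\<^bsub>F\<^esub>"

definition is_free_product ::
  "('a, 'b) monoid_scheme \<Rightarrow> 'i set \<Rightarrow> ('i \<Rightarrow> 'a set) \<Rightarrow> bool" where
  "is_free_product F I H \<longleftrightarrow>
     group F \<and> (\<forall>i\<in>I. subgroup (H i) F) \<and> generate F (\<Union>i\<in>I. H i) = carrier F \<and>
     (\<forall>w. reduced_word F I H w \<and> w \<noteq> [] \<longrightarrow> word_value F w \<noteq> \<one>\<^bsub>F\<^esub>)"

definition commutator_subgroup :: "('a, 'b) monoid_scheme \<Rightarrow> 'a set \<Rightarrow> 'a set \<Rightarrow> 'a set" where
  "commutator_subgroup G H K =
     generate G (\<Union>h\<in>H. \<Union>k\<in>K. {h \<otimes>\<^bsub>G\<^esub> k \<otimes>\<^bsub>G\<^esub> inv\<^bsub>G\<^esub> h \<otimes>\<^bsub>G\<^esub> inv\<^bsub>G\<^esub> k})"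

text \<open>The map \<open>x N \<mapsto> pr x\<close> on cosets of \<open>N\<close>; meaningful if \<open>pr\<close> is constant on them.\<close>

definition induced_map :: "('a \<Rightarrow> 'b) \<Rightarrow> 'a set \<Rightarrow> 'b" where
  "induced_map pr X = the_elem (pr ` X)"

text \<open>Only used for finite groups; nothing is claimed about groups of infinite exponent.\<close>

definition group_exp :: "('a, 'b) monoid_scheme \<Rightarrow> nat" where
  "group_exp G = (LEAST n. 0 < n \<and> (\<forall>x\<in>carrier G. x [^]\<^bsub>G\<^esub> n = \<one>\<^bsub>G\<^esub>))"

definition complex_units :: "complex monoid" where
  "complex_units = \<lparr>carrier = UNIV - {0}, mult = (*), one = 1\<rparr>"

text \<open>For \<open>s : G \<rightarrow> M\<close>, the function \<open>(x, y) \<mapsto> s(x) s(y) s(xy)\<^sup>-\<^sup>1\<close>. If \<open>M\<close> is abelian with trivial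
  \<open>G\<close>-action this is the coboundary of \<open>s\<close>; if \<open>s\<close> is a section of an extension \<open>M\<close> of \<open>G\<close>,
  it is the associated cocycle.\<close>

definition factor_set ::
  "('g, 'h) monoid_scheme \<Rightarrow> ('m, 'n) monoid_scheme \<Rightarrow> ('g \<Rightarrow> 'm) \<Rightarrow> 'g \<times> 'g \<Rightarrow> 'm" where
  "factor_set G M s =
     (\<lambda>(x, y)\<in>carrier G \<times> carrier G. s x \<otimes>\<^bsub>M\<^esub> s y \<otimes>\<^bsub>M\<^esub> inv\<^bsub>M\<^esub> (s (x \<otimes>\<^bsub>G\<^esub> y)))"

text \<open>Inhomogeneous cochains, not assumed normalised; \<open>G\<close> acts trivially on the abelian
  group \<open>M\<close>.\<close>

definition Z2 :: "('g, 'h) monoid_scheme \<Rightarrow> ('m, 'n) monoid_scheme \<Rightarrow> ('g \<times> 'g \<Rightarrow> 'm) monoid" where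
  "Z2 G M = (product_group (carrier G \<times> carrier G) (\<lambda>_. M))
     \<lparr>carrier := {c \<in> carrier G \<times> carrier G \<rightarrow>\<^sub>E carrier M.
        \<forall>x\<in>carrier G. \<forall>y\<in>carrier G. \<forall>z\<in>carrier G.
          c (x, y) \<otimes>\<^bsub>M\<^esub> c (x \<otimes>\<^bsub>G\<^esub> y, z) = c (y, z) \<otimes>\<^bsub>M\<^esub> c (x, y \<otimes>\<^bsub>G\<^esub> z)}\<rparr>"

definition B2 :: "('g, 'h) monoid_scheme \<Rightarrow> ('m, 'n) monoid_scheme \<Rightarrow> ('g \<times> 'g \<Rightarrow> 'm) set" where
  "B2 G M = factor_set G M ` (carrier G \<rightarrow> carrier M)"

definition H2 ::
  "('g, 'h) monoid_scheme \<Rightarrow> ('m, 'n) monoid_scheme \<Rightarrow> ('g \<times> 'g \<Rightarrow> 'm) set monoid" where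
  "H2 G M = Z2 G M Mod B2 G M"

definition cohomology_class ::
  "('g, 'h) monoid_scheme \<Rightarrow> ('m, 'n) monoid_scheme \<Rightarrow> ('g \<times> 'g \<Rightarrow> 'm) \<Rightarrow> ('g \<times> 'g \<Rightarrow> 'm) set" where
  "cohomology_class G M c = B2 G M #>\<^bsub>Z2 G M\<^esub> c"

text \<open>An extension \<open>1 \<rightarrow> A \<rightarrow> E \<rightarrow> G \<rightarrow> 1\<close> is given by the epimorphism \<open>p : E \<rightarrow> G\<close>, the subgroup
  \<open>A\<close> being its kernel.\<close>

definition finite_central_extension ::
  "('e, 'f) monoid_scheme \<Rightarrow> ('g, 'h) monoid_scheme \<Rightarrow> ('e \<Rightarrow> 'g) \<Rightarrow> bool" where
  "finite_central_extension E G p \<longleftrightarrow>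
     group E \<and> finite (carrier E) \<and> group G \<and> p \<in> epi E G \<and>
     (\<forall>a\<in>kernel E G p. \<forall>x\<in>carrier E. a \<otimes>\<^bsub>E\<^esub> x = x \<otimes>\<^bsub>E\<^esub> a)"

definition extension_cocycles ::
  "('e, 'f) monoid_scheme \<Rightarrow> ('g, 'h) monoid_scheme \<Rightarrow> ('e \<Rightarrow> 'g) \<Rightarrow> ('g \<times> 'g \<Rightarrow> 'e) set" where
  "extension_cocycles E G p =
     {factor_set G E s | s. s \<in> carrier G \<rightarrow> carrier E \<and> (\<forall>x\<in>carrier G. p (s x) = x)}"

text \<open>\<open>\<eta>(\<lambda>) = [\<lambda> \<circ> \<gamma>]\<close> in \<open>H\<^sup>2(G, \<complex>\<^sup>\<times>)\<close>.\<close>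

definition eta ::
  "('g, 'h) monoid_scheme \<Rightarrow> ('g \<times> 'g \<Rightarrow> 'e) \<Rightarrow> ('e \<Rightarrow> complex) \<Rightarrow> ('g \<times> 'g \<Rightarrow> complex) set" where
  "eta G \<gamma> l =
     cohomology_class G complex_units (restrict (l \<circ> \<gamma>) (carrier G \<times> carrier G))"

text \<open>A cover is a finite central extension for which \<open>\<eta> : Hom(A, \<complex>\<^sup>\<times>) \<rightarrow> H\<^sup>2(G, \<complex>\<^sup>\<times>)\<close> is
  surjective. The map \<open>\<eta>\<close> does not depend on the cocycle \<open>\<gamma>\<close> of the extension, and such cocycles
  exist since every epimorphism has a set-theoretic section.\<close>

definition is_cover ::
  "('e, 'f) monoid_scheme \<Rightarrow> ('g, 'h) monoid_scheme \<Rightarrow> ('e \<Rightarrow> 'g) \<Rightarrow> bool" where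
  "is_cover E G p \<longleftrightarrow>
     finite_central_extension E G p \<and>
     (\<forall>\<gamma>\<in>extension_cocycles E G p.
        eta G \<gamma> ` hom (E\<lparr>carrier := kernel E G p\<rparr>) complex_units =
          carrier (H2 G complex_units))"

end

theory Submission
  imports Defs
begin

text \<open>A finite central extension \<open>E\<close> of \<open>G\<close> is a cover iff for every 2-cocycle \<open>c\<close> with values in
  \<open>\<complex>\<^sup>\<times>\<close> there is a homomorphism over \<open>G\<close> from \<open>E\<close> to the extension of \<open>G\<close> by \<open>\<complex>\<^sup>\<times>\<close> defined by \<open>c\<close>.
  As \<open>\<complex>\<^sup>\<times>\<close> is divisible, the images of the generators of the free product \<open>F\<close> lift to elements of the
  required orders in this extension; the resulting homomorphism maps \<open>R\<close> into the centre and so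
  factors through \<open>F / [R, F]\<close>. The latter is finite by Dietzmann's lemma, being generated by
  finitely many torsion elements and having a centre of finite index.

  For minimality, let \<open>n\<close> kill a cover \<open>E'\<close> and suppose \<open>x\<^sup>n \<noteq> 1\<close> in \<open>E\<close>. Choose a character \<open>\<lambda>\<close>
  of the kernel with \<open>\<lambda>(x\<^sup>n) \<noteq> 1\<close>. Both \<open>E\<close> (via \<open>\<lambda>\<close>) and \<open>E'\<close> (being a cover) map to the extension
  of \<open>G\<close> by \<open>\<complex>\<^sup>\<times>\<close> given by \<open>\<lambda> \<circ> \<gamma>\<close>. A generator of \<open>E\<close> has the same order as its image in \<open>G\<close>, hence
  is killed by \<open>n\<close>, so its image differs from an element of the image of \<open>E'\<close> by an \<open>n\<close>-th root of
  unity. Hence \<open>n\<close> kills the image of all of \<open>E\<close>, contradicting \<open>\<lambda>(x\<^sup>n) \<noteq> 1\<close>.\<close>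

section \<open>Homomorphisms from free products\<close>

text \<open>Two exponents giving the same power of \<open>f\<close> differ by a multiple of
  \<open>ord f\<close>, hence by a multiple of the order of \<open>h\<close>, so sending powers of
  \<open>f\<close> to the same powers of \<open>h\<close> is unambiguous. The infinite cyclic case
  is included, with \<open>ord f = 0\<close>.\<close>

lemma (in group) hom_from_cyclic:
  assumes M: "group M" and f: "f \<in> carrier G" and h: "h \<in> carrier M" "h [^]\<^bsub>M\<^esub> ord f = \<one>\<^bsub>M\<^esub>"
  obtains \<psi> where "\<psi> \<in> hom (G\<lparr>carrier := generate G {f}\<rparr>) M" "\<psi> f = h"
proof -
  interpret M: group M by fact
  define \<psi> where "\<psi> x = h [^]\<^bsub>M\<^esub> (SOME k::int. f [^] k = x)" for x
  have dv: "M.ord h dvd ord f"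
    using h M.pow_eq_id by blast
  have \<psi>: "\<psi> (f [^] k) = h [^]\<^bsub>M\<^esub> k" for k :: int
  proof -
    have "f [^] (SOME j::int. f [^] j = f [^] k) = f [^] k"
      by (rule someI[where x = k]) simp
    then show ?thesis
      unfolding \<psi>_def using f h dv int_pow_eq M.int_pow_eq by (meson dvd_trans int_dvd_int_iff)
  qed
  show thesis
  proof
    show "\<psi> f = h"
      using \<psi>[of 1] f h by simp
    show "\<psi> \<in> hom (G\<lparr>carrier := generate G {f}\<rparr>) M"
      using f h by (auto simp: hom_def generate_pow \<psi> M.int_pow_mult simp flip: int_pow_mult)
  qed
qed

text \<open>The homomorphism is obtained through its graph, the subgroup of
  \<open>F \<times>\<times> M\<close> generated by the graphs of the given maps. This subgroup
  projects onto \<open>F\<close> because the factors generate, and it is single-valued because only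
  the empty reduced word represents the identity.\<close>

lemma free_product_universal:
  assumes fp: "is_free_product F I H" and M: "group M"
    and \<psi>: "\<And>i. i \<in> I \<Longrightarrow> \<psi> i \<in> hom (F\<lparr>carrier := H i\<rparr>) M"
  obtains \<phi> where "\<phi> \<in> hom F M" "\<And>i x. i \<in> I \<Longrightarrow> x \<in> H i \<Longrightarrow> \<phi> x = \<psi> i x"
proof -
  interpret M: group M by fact
  interpret F: group F using fp by (simp add: is_free_product_def)
  have sub: "subgroup (H i) F" if "i \<in> I" for i
    using fp that by (simp add: is_free_product_def)
  have Hc: "x \<in> carrier F" if "i \<in> I" "x \<in> H i" for i x
    using sub[OF that(1)] that(2) subgroup.subset by blast
  have \<psi>c: "\<psi> i x \<in> carrier M" if "i \<in> I" "x \<in> H i" for i x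
    using \<psi>[OF that(1)] that(2) by (auto simp: hom_def)
  have \<psi>m: "\<psi> i (x \<otimes>\<^bsub>F\<^esub> y) = \<psi> i x \<otimes>\<^bsub>M\<^esub> \<psi> i y" if "i \<in> I" "x \<in> H i" "y \<in> H i" for i x y
    using \<psi>[OF that(1)] that(2,3) by (auto simp: hom_def)
  have \<psi>1: "\<psi> i \<one>\<^bsub>F\<^esub> = \<one>\<^bsub>M\<^esub>" if "i \<in> I" for i
    using \<psi>m[OF that, of "\<one>\<^bsub>F\<^esub>" "\<one>\<^bsub>F\<^esub>"] \<psi>c[OF that, of "\<one>\<^bsub>F\<^esub>"] subgroup.one_closed[OF sub[OF that]]
    by (metis F.l_one F.one_closed M.r_cancel_one)
  define val where "val w = foldr (\<lambda>(i, h) y. \<psi> i h \<otimes>\<^bsub>M\<^esub> y) w \<one>\<^bsub>M\<^esub>" for w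
  have val_simps: "val [] = \<one>\<^bsub>M\<^esub>" "val ((i, h) # w) = \<psi> i h \<otimes>\<^bsub>M\<^esub> val w" for i h w
    by (simp_all add: val_def)
  have wv_simps: "word_value F [] = \<one>\<^bsub>F\<^esub>"
    "word_value F ((i, h) # w) = h \<otimes>\<^bsub>F\<^esub> word_value F w" for i h w
    by (simp_all add: word_value_def)
  have red_Cons: "reduced_word F I H ((i, h) # w) \<longleftrightarrow>
      i \<in> I \<and> h \<in> H i \<and> h \<noteq> \<one>\<^bsub>F\<^esub> \<and> reduced_word F I H w \<and> (w = [] \<or> fst (hd w) \<noteq> i)" for i h w
    by (cases w) (auto simp: reduced_word_def)
  have vals: "word_value F w \<in> carrier F \<and> val w \<in> carrier M" if "reduced_word F I H w" for w
    using that
  proof (induction w)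
    case (Cons a w)
    then show ?case
      by (cases a) (auto simp: red_Cons wv_simps val_simps intro: Hc \<psi>c)
  qed (simp add: wv_simps val_simps)
  \<comment> \<open>Each reduced word is evaluated in \<open>F\<close> and, through the maps
    \<open>\<psi> i\<close>, in \<open>M\<close>. The set \<open>S\<close> of these pairs of values
    will contain the subgroup generated by \<open>T\<close>.\<close>
  define S where "S = {(word_value F w, val w) | w. reduced_word F I H w}"
  define T where "T = {(x, \<psi> i x) | i x. i \<in> I \<and> x \<in> H i}"
  define D where "D = F \<times>\<times> M"
  interpret D: group D
    unfolding D_def by (simp add: DirProd_group F.group_axioms M.group_axioms)
  have T: "T \<subseteq> carrier D"
    using Hc \<psi>c by (auto simp: T_def D_def)
  have S: "S \<subseteq> carrier D"
    using vals by (auto simp: S_def D_def)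
  \<comment> \<open>If the word does not begin in the factor of the new syllable, the syllable is
    prepended, or dropped when trivial. Otherwise it merges with the first syllable; should the
    product be trivial, that syllable disappears and the tail is still reduced.\<close>
  have step: "t \<otimes>\<^bsub>D\<^esub> s \<in> S" if "t \<in> T" "s \<in> S" for t s
  proof -
    obtain i x where t: "t = (x, \<psi> i x)" and i: "i \<in> I" and x: "x \<in> H i"
      using \<open>t \<in> T\<close> by (auto simp: T_def)
    obtain w where s: "s = (word_value F w, val w)" and w: "reduced_word F I H w"
      using \<open>s \<in> S\<close> by (auto simp: S_def)
    have "\<exists>w'. reduced_word F I H w' \<and> word_value F w' = x \<otimes>\<^bsub>F\<^esub> word_value F w
        \<and> val w' = \<psi> i x \<otimes>\<^bsub>M\<^esub> val w"
    proof (cases "w = [] \<or> fst (hd w) \<noteq> i")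
      case True
      show ?thesis
      proof (cases "x = \<one>\<^bsub>F\<^esub>")
        case True
        then show ?thesis
          using w i vals[OF w] by (intro exI[of _ w]) (simp add: \<psi>1)
      next
        case False
        with \<open>w = [] \<or> fst (hd w) \<noteq> i\<close> show ?thesis
          using w i x by (intro exI[of _ "(i, x) # w"]) (simp add: red_Cons wv_simps val_simps)
      qed
    next
      case False
      then obtain y v where wv: "w = (i, y) # v"
        by (cases w) auto
      with w have y: "y \<in> H i" and v: "reduced_word F I H v" and hd: "v = [] \<or> fst (hd v) \<noteq> i"
        by (auto simp: red_Cons)
      note c = Hc[OF i x] Hc[OF i y] \<psi>c[OF i x] \<psi>c[OF i y] vals[OF v]
      have xy: "x \<otimes>\<^bsub>F\<^esub> y \<in> H i"
        using subgroup.m_closed[OF sub[OF i]] x y by blast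
      have eqs: "x \<otimes>\<^bsub>F\<^esub> word_value F w = (x \<otimes>\<^bsub>F\<^esub> y) \<otimes>\<^bsub>F\<^esub> word_value F v"
        "\<psi> i x \<otimes>\<^bsub>M\<^esub> val w = \<psi> i (x \<otimes>\<^bsub>F\<^esub> y) \<otimes>\<^bsub>M\<^esub> val v"
        using c by (simp_all add: wv wv_simps val_simps \<psi>m i x y F.m_assoc M.m_assoc)
      show ?thesis
      proof (cases "x \<otimes>\<^bsub>F\<^esub> y = \<one>\<^bsub>F\<^esub>")
        case True
        then show ?thesis
          using v c eqs by (intro exI[of _ v]) (simp add: \<psi>1 i)
      next
        case False
        then show ?thesis
          using v i xy hd eqs
          by (intro exI[of _ "(i, x \<otimes>\<^bsub>F\<^esub> y) # v"]) (simp add: red_Cons wv_simps val_simps)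
      qed
    qed
    then show ?thesis
      by (auto simp: S_def D_def t s) metis
  qed
  have invT: "inv\<^bsub>D\<^esub> t \<in> T" if "t \<in> T" for t
  proof -
    obtain i x where t: "t = (x, \<psi> i x)" and i: "i \<in> I" and x: "x \<in> H i"
      using \<open>t \<in> T\<close> by (auto simp: T_def)
    have ix: "inv\<^bsub>F\<^esub> x \<in> H i"
      using subgroup.m_inv_closed[OF sub[OF i]] x by blast
    have "\<psi> i (inv\<^bsub>F\<^esub> x) \<otimes>\<^bsub>M\<^esub> \<psi> i x = \<one>\<^bsub>M\<^esub>"
      using \<psi>m[OF i ix x] \<psi>1[OF i] Hc[OF i x] by simp
    then have "\<psi> i (inv\<^bsub>F\<^esub> x) = inv\<^bsub>M\<^esub> (\<psi> i x)"
      using \<psi>c i ix x by (metis M.inv_equality)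
    then show ?thesis
      using i ix Hc[OF i x] \<psi>c[OF i x]
      by (auto simp: t D_def T_def F.group_axioms M.group_axioms intro!: exI[of _ i])
  qed
  define K where "K = generate D T"
  have K: "subgroup K D"
    unfolding K_def by (rule D.generate_is_subgroup[OF T])
  \<comment> \<open>Stability of \<open>S\<close> under left multiplication passes from the
    generators and their inverses to all of \<open>K\<close>. Applied to the identity, which lies in
    \<open>S\<close>, it gives \<open>K \<subseteq> S\<close>.\<close>
  have "\<forall>s\<in>S. u \<otimes>\<^bsub>D\<^esub> s \<in> S" if "u \<in> K" for u
    using that unfolding K_def
  proof (induction)
    case one
    then show ?case using S by auto
  next
    case (eng a b)
    show ?case
    proof
      fix s assume s: "s \<in> S"
      then have "a \<otimes>\<^bsub>D\<^esub> (b \<otimes>\<^bsub>D\<^esub> s) \<in> S"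
        using eng.IH by blast
      moreover have "s \<in> carrier D" "a \<in> carrier D" "b \<in> carrier D"
        using s S eng.hyps D.generate_in_carrier[OF T] by auto
      ultimately show "a \<otimes>\<^bsub>D\<^esub> b \<otimes>\<^bsub>D\<^esub> s \<in> S"
        by (simp add: D.m_assoc)
    qed
  qed (auto simp: step invT)
  moreover have "\<one>\<^bsub>D\<^esub> \<in> S"
    by (auto simp: S_def D_def reduced_word_def wv_simps val_simps intro!: exI[of _ "[]"])
  ultimately have KS: "K \<subseteq> S"
    using subgroup.subset[OF K] by (metis D.r_one subsetD subsetI)
  \<comment> \<open>The quotient of two points over the same \<open>x\<close> has first component
    one. It comes from a reduced word, which must then be empty, so its second component is one as
    well.\<close>
  have unique: "y = z" if "(x, y) \<in> K" "(x, z) \<in> K" for x y z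
  proof -
    have c: "x \<in> carrier F" "y \<in> carrier M" "z \<in> carrier M"
      using that subgroup.subset[OF K] by (auto simp: D_def)
    have "(x, y) \<otimes>\<^bsub>D\<^esub> inv\<^bsub>D\<^esub> (x, z) \<in> K"
      using that K by (simp add: subgroup.m_closed subgroup.m_inv_closed)
    then have "(\<one>\<^bsub>F\<^esub>, y \<otimes>\<^bsub>M\<^esub> inv\<^bsub>M\<^esub> z) \<in> S"
      using KS c by (auto simp: D_def F.group_axioms M.group_axioms)
    then obtain w where w: "reduced_word F I H w" "word_value F w = \<one>\<^bsub>F\<^esub>" "val w = y \<otimes>\<^bsub>M\<^esub> inv\<^bsub>M\<^esub> z"
      by (auto simp: S_def)
    with fp have "w = []"
      by (auto simp: is_free_product_def)
    with w c show ?thesis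
      by (simp add: val_simps) (metis M.inv_solve_right' M.l_one M.one_closed)
  qed
  have "fst \<in> hom D F"
    by (auto simp: D_def hom_def)
  then interpret fst: group_hom D F fst
    by (simp add: group_hom_def group_hom_axioms_def D.group_axioms F.group_axioms)
  have "fst ` K = generate F (fst ` T)"
    unfolding K_def by (rule fst.generate_img[OF T, symmetric])
  also have "fst ` T = (\<Union>i\<in>I. H i)"
    by (force simp: T_def image_iff)
  also have "generate F \<dots> = carrier F"
    using fp by (simp add: is_free_product_def)
  finally have "\<exists>y. (x, y) \<in> K" if "x \<in> carrier F" for x
    using that by force
  then obtain \<phi> where \<phi>: "\<And>x. x \<in> carrier F \<Longrightarrow> (x, \<phi> x) \<in> K"
    by metis
  show thesis
  proof
    show "\<phi> x = \<psi> i x" if "i \<in> I" "x \<in> H i" for i x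
    proof (rule unique[OF \<phi>[OF Hc[OF that]]])
      show "(x, \<psi> i x) \<in> K"
        using that by (auto simp: K_def T_def intro: generate.incl)
    qed
    show "\<phi> \<in> hom F M"
    proof (rule homI)
      show "\<phi> x \<in> carrier M" if "x \<in> carrier F" for x
        using \<phi>[OF that] subgroup.subset[OF K] by (auto simp: D_def)
      show "\<phi> (x \<otimes>\<^bsub>F\<^esub> y) = \<phi> x \<otimes>\<^bsub>M\<^esub> \<phi> y" if "x \<in> carrier F" "y \<in> carrier F" for x y
      proof (rule unique[OF \<phi>])
        show "x \<otimes>\<^bsub>F\<^esub> y \<in> carrier F" using that by simp
        show "(x \<otimes>\<^bsub>F\<^esub> y, \<phi> x \<otimes>\<^bsub>M\<^esub> \<phi> y) \<in> K"
          using subgroup.m_closed[OF K \<phi>[OF that(1)] \<phi>[OF that(2)]] by (simp add: D_def)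
      qed
    qed
  qed
qed

section \<open>Finiteness\<close>

text \<open>Dietzmann's lemma: in a product over \<open>X\<close> all occurrences of one element can be collected
  at the front by conjugating the other factors, so a word with \<open>m\<close> equal letters can be
  shortened and every element is a product of at most \<open>card X * m\<close> letters.\<close>

lemma (in group) finite_if_generated_by_torsion:
  assumes X: "finite X" "X \<subseteq> carrier G" "generate G X = carrier G"
    and conj: "\<And>x y. x \<in> carrier G \<Longrightarrow> y \<in> X \<Longrightarrow> x \<otimes> y \<otimes> inv x \<in> X"
    and m: "m > 0" "\<And>x. x \<in> X \<Longrightarrow> x [^] (m::nat) = \<one>"
  shows "finite (carrier G)"
proof -
  define val where "val w = foldr (\<otimes>) w \<one>" for w
  have val_simps: "val [] = \<one>" "val (x # w) = x \<otimes> val w" for x w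
    by (simp_all add: val_def)
  have val_closed: "val w \<in> carrier G" if "set w \<subseteq> X" for w
    using that X by (induction w) (auto simp: val_simps)
  have val_append: "val (v @ w) = val v \<otimes> val w" if "set v \<subseteq> X" "set w \<subseteq> X" for v w
    using that X val_closed by (induction v) (auto simp: val_simps m_assoc subset_iff)
  have collect: "\<exists>w'. set w' \<subseteq> X \<and> length w' + k = length w \<and> val w = x [^] k \<otimes> val w'"
    if "x \<in> X" "set w \<subseteq> X" "k \<le> count_list w x" for x w k
    using that(2,3)
  proof (induction w arbitrary: k)
    case Nil
    then show ?case by (auto simp: val_simps)
  next
    case (Cons y w)
    have y: "y \<in> X" and w: "set w \<subseteq> X" using Cons.prems by auto
    have yx: "y \<in> carrier G" "x \<in> carrier G" using y that X by auto
    show ?case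
    proof (cases k)
      case 0
      then show ?thesis
        using Cons.prems val_closed[of "y # w"] by (intro exI[of _ "y # w"]) auto
    next
      case (Suc j)
      show ?thesis
      proof (cases "y = x")
        case True
        then have "j \<le> count_list w x" using Cons.prems Suc by simp
        from Cons.IH[OF w this] obtain w' where w': "set w' \<subseteq> X" "length w' + j = length w"
          "val w = x [^] j \<otimes> val w'" by auto
        moreover have "x \<otimes> (x [^] j \<otimes> val w') = x [^] k \<otimes> val w'"
          using yx val_closed[OF w'(1)] nat_pow_Suc2[of x j] Suc by (simp add: m_assoc)
        ultimately show ?thesis
          using True Suc by (intro exI[of _ w']) (simp add: val_simps)
      next
        case False
        then have "k \<le> count_list w x" using Cons.prems by simp
        from Cons.IH[OF w this] obtain w' where w': "set w' \<subseteq> X" "length w' + k = length w"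
          "val w = x [^] k \<otimes> val w'" by auto
        \<comment> \<open>Moving \<open>x [^] k\<close> to the left past \<open>y\<close> replaces
          \<open>y\<close> by this conjugate, which is again a letter, so the count of letters stays
          right.\<close>
        define z where "z = inv (x [^] k) \<otimes> y \<otimes> x [^] k"
        have z: "z \<in> X"
          using conj[of "inv (x [^] k)" y] y yx by (simp add: z_def)
        have "y \<otimes> (x [^] k \<otimes> val w') = x [^] k \<otimes> (z \<otimes> val w')"
          using yx val_closed[OF w'(1)] by (simp add: z_def inv_solve_left flip: m_assoc)
        then show ?thesis
          using w' z by (intro exI[of _ "z # w'"]) (simp add: val_simps)
      qed
    qed
  qed
  define L where "L = {w. set w \<subseteq> X \<and> length w \<le> card X * m}"
  have finL: "finite L"
    unfolding L_def by (rule finite_lists_length_le[OF X(1)])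
  have short: "val w \<in> val ` L" if "set w \<subseteq> X" for w
    using that
  proof (induction "length w" arbitrary: w rule: less_induct)
    case less
    show ?case
    proof (cases "length w \<le> card X * m")
      case True
      then show ?thesis using less.prems by (auto simp: L_def)
    next
      case False
      \<comment> \<open>Pigeonhole: if every letter occurred fewer than \<open>m\<close> times, the
        length could not exceed \<open>card X * m\<close>. Collecting \<open>m\<close> copies of the
        letter found here removes them, since their product is one.\<close>
      have "\<exists>x\<in>X. m \<le> count_list w x"
      proof (rule ccontr)
        assume "\<not> ?thesis"
        then have "(\<Sum>x\<in>X. count_list w x) \<le> (\<Sum>x\<in>X. m)"
          by (intro sum_mono) auto
        moreover have "(\<Sum>x\<in>X. count_list w x) = length w"
          using less.prems X(1) by (metis sum_count_set)
        ultimately show False using False by simp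
      qed
      then obtain x where x: "x \<in> X" "m \<le> count_list w x" by auto
      from collect[OF x(1) less.prems x(2)] obtain w' where w': "set w' \<subseteq> X"
        "length w' + m = length w" "val w = x [^] m \<otimes> val w'" by auto
      have "val w = val w'"
        using w' m(2)[OF x(1)] val_closed[OF w'(1)] by simp
      moreover have "val w' \<in> val ` L"
        using w' m(1) by (intro less.hyps) auto
      ultimately show ?thesis by simp
    qed
  qed
  have "carrier G \<subseteq> val ` {w. set w \<subseteq> X}"
  proof
    fix g assume "g \<in> carrier G"
    then have "g \<in> generate G X" by (simp add: X)
    then show "g \<in> val ` {w. set w \<subseteq> X}"
    proof (induction rule: generate.induct)
      case one
      show ?case by (rule image_eqI[of _ _ "[]"]) (auto simp: val_simps)
    next
      case (incl h)
      then show ?case using X by (intro image_eqI[of _ _ "[h]"]) (auto simp: val_simps)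
    next
      case (inv h)
      have rep: "val (replicate k h) = h [^] k" for k
        using inv X nat_pow_Suc2[of h] by (induction k) (auto simp: val_simps subset_iff)
      \<comment> \<open>Inverses of letters are natural powers of letters, so words without formal
        inverses already give the whole group.\<close>
      have "h [^] (m - 1) = inv h"
      proof (rule inv_equality[symmetric])
        show "h [^] (m - 1) \<otimes> h = \<one>"
          using m inv by (metis Suc_diff_1 nat_pow_Suc)
      qed (use inv X in auto)
      with rep[of "m - 1"] show ?case
        using inv by (intro image_eqI[of _ _ "replicate (m - 1) h"]) auto
    next
      case (eng g h)
      then obtain v w where "g = val v" "set v \<subseteq> X" "h = val w" "set w \<subseteq> X" by auto
      then show ?case
        by (intro image_eqI[of _ _ "v @ w"]) (auto simp: val_append)
    qed
  qed
  with short have "carrier G \<subseteq> val ` L" by blast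
  with finL show ?thesis by (metis finite_imageI finite_subset)
qed

text \<open>Conjugation by \<open>e\<close> depends only on \<open>p e\<close>, because the kernel
  is central, so each generator has only finitely many conjugates. The set \<open>Y\<close> of all
  these conjugates satisfies the hypotheses of Dietzmann's lemma.\<close>

lemma finite_central_extension_of_torsion:
  assumes h: "group_hom E G p" and G: "finite (carrier G)"
    and central: "\<And>a x. a \<in> kernel E G p \<Longrightarrow> x \<in> carrier E \<Longrightarrow> a \<otimes>\<^bsub>E\<^esub> x = x \<otimes>\<^bsub>E\<^esub> a"
    and X: "finite X" "X \<subseteq> carrier E" "generate E X = carrier E"
    and tors: "\<And>x. x \<in> X \<Longrightarrow> 0 < group.ord E x"
  shows "finite (carrier E)"
proof -
  interpret group_hom E G p by fact
  define c where "c e x = e \<otimes>\<^bsub>E\<^esub> x \<otimes>\<^bsub>E\<^esub> inv\<^bsub>E\<^esub> e" for e x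
  define Y where "Y = (\<Union>x\<in>X. (\<lambda>e. c e x) ` carrier E)"
  have c_eq: "c e x = c e' x" if "e \<in> carrier E" "e' \<in> carrier E" "x \<in> carrier E" "p e = p e'" for e e' x
  proof -
    define a where "a = inv\<^bsub>E\<^esub> e' \<otimes>\<^bsub>E\<^esub> e"
    have a: "a \<in> kernel E G p" "a \<in> carrier E"
      using that by (auto simp: a_def kernel_def)
    have e: "e = e' \<otimes>\<^bsub>E\<^esub> a"
      using that by (simp add: a_def flip: G.m_assoc)
    have "e' \<otimes>\<^bsub>E\<^esub> a \<otimes>\<^bsub>E\<^esub> x = e' \<otimes>\<^bsub>E\<^esub> x \<otimes>\<^bsub>E\<^esub> a"
      using central[OF a(1) that(3)] that a(2) by (simp add: G.m_assoc)
    then have "c e x = e' \<otimes>\<^bsub>E\<^esub> x \<otimes>\<^bsub>E\<^esub> a \<otimes>\<^bsub>E\<^esub> inv\<^bsub>E\<^esub> (e' \<otimes>\<^bsub>E\<^esub> a)"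
      by (simp add: c_def e)
    also have "\<dots> = c e' x"
      using that a(2) by (simp add: c_def G.inv_mult_group G.m_assoc) (simp flip: G.m_assoc)
    finally show ?thesis .
  qed
  have "finite ((\<lambda>e. c e x) ` carrier E)" if "x \<in> X" for x
  proof -
    have "(\<lambda>e. c e x) ` carrier E \<subseteq> (\<lambda>g. c (SOME e. e \<in> carrier E \<and> p e = g) x) ` p ` carrier E"
    proof clarify
      fix e assume e: "e \<in> carrier E"
      then have "(SOME e'. e' \<in> carrier E \<and> p e' = p e) \<in> carrier E \<and>
          p (SOME e'. e' \<in> carrier E \<and> p e' = p e) = p e"
        by (intro someI[where P = "\<lambda>e'. e' \<in> carrier E \<and> p e' = p e"]) auto
      then have "c e x = c (SOME e'. e' \<in> carrier E \<and> p e' = p e) x"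
        using e that X by (intro c_eq) auto
      then show "c e x \<in> (\<lambda>g. c (SOME e. e \<in> carrier E \<and> p e = g) x) ` p ` carrier E"
        using e by blast
    qed
    moreover have "finite (p ` carrier E)"
      using G by (rule finite_subset[rotated]) auto
    ultimately show ?thesis by (meson finite_imageI finite_subset)
  qed
  with X have Y: "finite Y" by (auto simp: Y_def)
  have YE: "Y \<subseteq> carrier E" using X by (auto simp: Y_def c_def)
  have "x \<in> Y" if "x \<in> X" for x
    using that X by (auto simp: Y_def c_def intro!: bexI[of _ x] image_eqI[of _ _ "\<one>\<^bsub>E\<^esub>"])
  then have "carrier E \<subseteq> generate E Y"
    using X by (metis G.mono_generate subsetI)
  then have gen: "generate E Y = carrier E"
    using G.generate_incl[OF YE] by blast
  \<comment> \<open>The product of the orders is a common exponent of the generators, and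
    conjugation preserves exponents.\<close>
  define m where "m = (\<Prod>x\<in>X. group.ord E x)"
  show ?thesis
  proof (rule G.finite_if_generated_by_torsion[OF Y YE gen])
    show "m > 0" using tors by (auto simp: m_def intro: prod_pos)
    show "y [^]\<^bsub>E\<^esub> m = \<one>\<^bsub>E\<^esub>" if y: "y \<in> Y" for y
    proof -
      obtain x e where x: "x \<in> X" and e: "e \<in> carrier E" and yx: "y = c e x"
        using y by (auto simp: Y_def)
      have xE: "x \<in> carrier E" using x X by auto
      have "group.ord E x dvd m" unfolding m_def by (rule dvd_prodI[OF X(1) x])
      then have xm: "x [^]\<^bsub>E\<^esub> m = \<one>\<^bsub>E\<^esub>" using xE G.pow_eq_id by blast
      have "c e x [^]\<^bsub>E\<^esub> k = c e (x [^]\<^bsub>E\<^esub> k)" for k :: nat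
      proof (induction k)
        case (Suc k)
        then have "c e x [^]\<^bsub>E\<^esub> Suc k = c e (x [^]\<^bsub>E\<^esub> k) \<otimes>\<^bsub>E\<^esub> c e x" by simp
        also have "\<dots> = c e (x [^]\<^bsub>E\<^esub> Suc k)"
          using e xE by (simp add: c_def G.m_assoc) (simp flip: G.m_assoc)
        finally show ?case .
      qed (use e in \<open>simp add: c_def\<close>)
      then show ?thesis using xm e by (simp add: yx c_def)
    qed
    show "x \<otimes>\<^bsub>E\<^esub> y \<otimes>\<^bsub>E\<^esub> inv\<^bsub>E\<^esub> x \<in> Y" if xy: "x \<in> carrier E" "y \<in> Y" for x y
    proof -
      obtain z e where z: "z \<in> X" and e: "e \<in> carrier E" and yz: "y = c e z"
        using xy by (auto simp: Y_def)
      have zE: "z \<in> carrier E" "x \<in> carrier E" using z X xy by auto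
      have "x \<otimes>\<^bsub>E\<^esub> y \<otimes>\<^bsub>E\<^esub> inv\<^bsub>E\<^esub> x = c (x \<otimes>\<^bsub>E\<^esub> e) z"
        using e zE by (simp add: yz c_def G.m_assoc G.inv_mult_group)
      then show ?thesis using e z zE by (auto simp: Y_def)
    qed
  qed
qed

section \<open>Characters\<close>

lemma complex_units_simps [simp]:
  "carrier complex_units = UNIV - {0}" "x \<otimes>\<^bsub>complex_units\<^esub> y = x * y" "\<one>\<^bsub>complex_units\<^esub> = 1"
  by (simp_all add: complex_units_def)

lemma comm_group_complex_units: "comm_group complex_units"
proof (rule comm_groupI)
  show "\<exists>y\<in>carrier complex_units. y \<otimes>\<^bsub>complex_units\<^esub> x = \<one>\<^bsub>complex_units\<^esub>"
    if "x \<in> carrier complex_units" for x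
    using that by (intro bexI[of _ "inverse x"]) auto
qed auto

interpretation CU: comm_group complex_units
  by (rule comm_group_complex_units)

lemma complex_units_pow [simp]: "x [^]\<^bsub>complex_units\<^esub> (n::nat) = x ^ n"
  by (induction n) simp_all

lemma exists_complex_root:
  fixes z :: complex
  assumes "0 < n"
  obtains w where "w ^ n = z"
proof (cases "z = 0")
  case True
  then show thesis using assms that[of 0] by (simp add: power_0_left)
next
  case False
  have "(of_real (root n (cmod z)) * cis (Arg z / n)) ^ n = z"
    using assms False
    by (simp add: power_mult_distrib DeMoivre of_real_power[symmetric] rcis_cmod_Arg[unfolded rcis_def]
        del: of_real_power)
  then show thesis using that by blast
qed

lemma extend_character:
  assumes A: "comm_group A" and fin: "finite (carrier A)" and H: "subgroup H A"
    and \<chi>: "\<chi> \<in> hom (A\<lparr>carrier := H\<rparr>) complex_units" and x: "x \<in> carrier A"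
  obtains K \<chi>' where "subgroup K A" "H \<subseteq> K" "x \<in> K" "\<chi>' \<in> hom (A\<lparr>carrier := K\<rparr>) complex_units"
    "\<And>h. h \<in> H \<Longrightarrow> \<chi>' h = \<chi> h"
proof -
  interpret A: comm_group A by fact
  interpret H: subgroup H A by fact
  note Hc = H.mem_carrier
  have \<chi>0: "\<chi> h \<noteq> 0" if "h \<in> H" for h
    using \<chi> that by (auto simp: hom_def)
  have \<chi>m: "\<chi> (h \<otimes>\<^bsub>A\<^esub> k) = \<chi> h * \<chi> k" if "h \<in> H" "k \<in> H" for h k
    using \<chi> that by (auto simp: hom_def)
  have \<chi>1: "\<chi> \<one>\<^bsub>A\<^esub> = 1"
    using \<chi>m[of "\<one>\<^bsub>A\<^esub>" "\<one>\<^bsub>A\<^esub>"] \<chi>0[of "\<one>\<^bsub>A\<^esub>"] H.one_closed by simp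
  have Hpow: "h [^]\<^bsub>A\<^esub> (n::nat) \<in> H" "\<chi> (h [^]\<^bsub>A\<^esub> n) = \<chi> h ^ n" if "h \<in> H" for h n
  proof (induction n)
    case (Suc n)
    case 1 show ?case using Suc that by simp
    case 2 show ?case using Suc that by (simp add: \<chi>m)
  qed (simp_all add: \<chi>1)
  define m where "m = (LEAST n. 0 < n \<and> x [^]\<^bsub>A\<^esub> (n::nat) \<in> H)"
  have ordx: "0 < A.ord x"
    using A.ord_ge_1[OF fin x] by simp
  have "0 < A.ord x \<and> x [^]\<^bsub>A\<^esub> A.ord x \<in> H"
    using ordx x by simp
  then have m: "0 < m" "x [^]\<^bsub>A\<^esub> m \<in> H"
    unfolding m_def by (metis (mono_tags, lifting) LeastI)+
  obtain v where v: "v ^ m = \<chi> (x [^]\<^bsub>A\<^esub> m)"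
    using exists_complex_root[OF m(1)] by blast
  then have v0: "v \<noteq> 0"
    using \<chi>0[OF m(2)] m(1) by (auto simp: power_0_left)
  \<comment> \<open>Division by \<open>m\<close> leaves a power of \<open>x\<close> in
    \<open>H\<close> with exponent less than \<open>m\<close>, so minimality forces remainder zero.
    Hence \<open>v\<close> agrees with \<chi> on every power of \<open>x\<close> that lies in
    \<open>H\<close>.\<close>
  have pow: "\<chi> (x [^]\<^bsub>A\<^esub> n) = v ^ n" if n: "x [^]\<^bsub>A\<^esub> (n::nat) \<in> H" for n
  proof -
    have "x [^]\<^bsub>A\<^esub> n = (x [^]\<^bsub>A\<^esub> m) [^]\<^bsub>A\<^esub> (n div m) \<otimes>\<^bsub>A\<^esub> x [^]\<^bsub>A\<^esub> (n mod m)"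
      using x by (simp add: A.nat_pow_pow A.nat_pow_mult)
    then have "x [^]\<^bsub>A\<^esub> (n mod m) = inv\<^bsub>A\<^esub> ((x [^]\<^bsub>A\<^esub> m) [^]\<^bsub>A\<^esub> (n div m)) \<otimes>\<^bsub>A\<^esub> x [^]\<^bsub>A\<^esub> n"
      using x by (simp flip: A.m_assoc)
    then have "x [^]\<^bsub>A\<^esub> (n mod m) \<in> H"
      using n Hpow(1)[OF m(2)] by simp
    then have "n mod m = 0"
      using m(1) not_less_Least[of "n mod m" "\<lambda>n. 0 < n \<and> x [^]\<^bsub>A\<^esub> (n::nat) \<in> H"]
      unfolding m_def[symmetric] by auto
    then obtain q where "n = m * q" by auto
    then show ?thesis
      using x v Hpow(2)[OF m(2), of q] by (simp add: A.nat_pow_pow[symmetric] power_mult)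
  qed
  define K where "K = {h \<otimes>\<^bsub>A\<^esub> x [^]\<^bsub>A\<^esub> (k::nat) | h k. h \<in> H}"
  \<comment> \<open>\<open>P\<close> is the graph of the extended character on \<open>K\<close>.
    Natural exponents suffice, since in a finite group inverses are natural powers.\<close>
  define P where "P y z \<longleftrightarrow> (\<exists>h k. h \<in> H \<and> y = h \<otimes>\<^bsub>A\<^esub> x [^]\<^bsub>A\<^esub> (k::nat) \<and> z = \<chi> h * v ^ k)" for y z
  have wd: "\<chi> h * v ^ j = \<chi> g * v ^ k"
    if "h \<in> H" "g \<in> H" "h \<otimes>\<^bsub>A\<^esub> x [^]\<^bsub>A\<^esub> (j::nat) = g \<otimes>\<^bsub>A\<^esub> x [^]\<^bsub>A\<^esub> (k::nat)" "j \<le> k" for h g j k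
  proof -
    have c: "h \<in> carrier A" "g \<in> carrier A" using that Hc by auto
    have "g \<otimes>\<^bsub>A\<^esub> x [^]\<^bsub>A\<^esub> k = (g \<otimes>\<^bsub>A\<^esub> x [^]\<^bsub>A\<^esub> (k - j)) \<otimes>\<^bsub>A\<^esub> x [^]\<^bsub>A\<^esub> j"
      using that(4) x c by (simp add: A.m_assoc A.nat_pow_mult)
    then have h: "h = g \<otimes>\<^bsub>A\<^esub> x [^]\<^bsub>A\<^esub> (k - j)"
      using that(3) c x by simp
    then have "x [^]\<^bsub>A\<^esub> (k - j) = inv\<^bsub>A\<^esub> g \<otimes>\<^bsub>A\<^esub> h"
      using c x by (simp flip: A.m_assoc)
    then have *: "x [^]\<^bsub>A\<^esub> (k - j) \<in> H"
      using that by simp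
    then have "\<chi> h = \<chi> g * v ^ (k - j)"
      using h pow[OF *] \<chi>m[OF that(2) *] by simp
    then show ?thesis
      using that(4) by (simp flip: power_add)
  qed
  have P_unique: "z = z'" if "P y z" "P y z'" for y z z'
    using that wd unfolding P_def by (metis nat_le_linear)
  have P_ex: "\<exists>z. P y z" if "y \<in> K" for y
    using that unfolding P_def K_def by blast
  obtain \<chi>' where \<chi>': "\<And>y. y \<in> K \<Longrightarrow> P y (\<chi>' y)"
    using P_ex by metis
  have P_mult: "P (y \<otimes>\<^bsub>A\<^esub> y') (z * z')" if P: "P y z" "P y' z'" for y y' z z'
  proof -
    obtain h k h' k' where y: "h \<in> H" "y = h \<otimes>\<^bsub>A\<^esub> x [^]\<^bsub>A\<^esub> (k::nat)" "z = \<chi> h * v ^ k"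
      "h' \<in> H" "y' = h' \<otimes>\<^bsub>A\<^esub> x [^]\<^bsub>A\<^esub> (k'::nat)" "z' = \<chi> h' * v ^ k'"
      using P unfolding P_def by blast
    have "y \<otimes>\<^bsub>A\<^esub> y' = (h \<otimes>\<^bsub>A\<^esub> h') \<otimes>\<^bsub>A\<^esub> x [^]\<^bsub>A\<^esub> (k + k')"
      using y x Hc by (simp add: A.m_ac flip: A.nat_pow_mult)
    moreover have "z * z' = \<chi> (h \<otimes>\<^bsub>A\<^esub> h') * v ^ (k + k')"
      using y by (simp add: \<chi>m power_add)
    ultimately show ?thesis
      using y H.m_closed unfolding P_def by blast
  qed
  have P_K: "y \<in> K" if "P y z" for y z
    using that unfolding P_def K_def by blast
  have P_H: "P h (\<chi> h)" if "h \<in> H" for h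
    using that Hc unfolding P_def by (intro exI[of _ h] exI[of _ 0]) simp
  have P_x: "P x v"
    using x \<chi>1 unfolding P_def by (intro exI[of _ "\<one>\<^bsub>A\<^esub>"] exI[of _ 1]) simp
  have mult_K: "y \<otimes>\<^bsub>A\<^esub> y' \<in> K" if "y \<in> K" "y' \<in> K" for y y'
    using P_K P_mult \<chi>' that by blast
  have K_carrier: "K \<subseteq> carrier A"
    using x Hc by (auto simp: K_def)
  show thesis
  proof
    show "subgroup K A"
    proof (rule A.subgroupI)
      show "inv\<^bsub>A\<^esub> y \<in> K" if "y \<in> K" for y
      proof -
        have yA: "y \<in> carrier A" using that K_carrier by blast
        have "y [^]\<^bsub>A\<^esub> n \<in> K" for n :: nat
        proof (induction n)
          case 0
          show ?case using P_K[OF P_H[OF H.one_closed]] by simp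
        qed (simp add: mult_K that)
        moreover have "inv\<^bsub>A\<^esub> y = y [^]\<^bsub>A\<^esub> (A.ord y - 1)"
        proof (rule A.inv_equality)
          show "y [^]\<^bsub>A\<^esub> (A.ord y - 1) \<otimes>\<^bsub>A\<^esub> y = \<one>\<^bsub>A\<^esub>"
            using A.pow_ord_eq_1[OF yA] A.ord_ge_1[OF fin yA]
            by (metis Suc_diff_le diff_Suc_1' nat_pow_Suc One_nat_def)
        qed (use yA in auto)
        ultimately show ?thesis by simp
      qed
    qed (use K_carrier mult_K P_K[OF P_x] in auto)
    show "\<chi>' \<in> hom (A\<lparr>carrier := K\<rparr>) complex_units"
    proof (rule homI)
      fix y assume "y \<in> carrier (A\<lparr>carrier := K\<rparr>)"
      then have "P y (\<chi>' y)" using \<chi>' by simp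
      then show "\<chi>' y \<in> carrier complex_units"
        using \<chi>0 v0 by (auto simp: P_def)
    next
      fix y z assume "y \<in> carrier (A\<lparr>carrier := K\<rparr>)" "z \<in> carrier (A\<lparr>carrier := K\<rparr>)"
      then have "P (y \<otimes>\<^bsub>A\<^esub> z) (\<chi>' y * \<chi>' z)" "P (y \<otimes>\<^bsub>A\<^esub> z) (\<chi>' (y \<otimes>\<^bsub>A\<^esub> z))"
        using P_mult \<chi>' mult_K by auto
      then show "\<chi>' (y \<otimes>\<^bsub>A\<lparr>carrier := K\<rparr>\<^esub> z) = \<chi>' y \<otimes>\<^bsub>complex_units\<^esub> \<chi>' z"
        using P_unique by simp
    qed
    show "H \<subseteq> K" "x \<in> K" using P_K P_H P_x by blast+
    show "\<chi>' h = \<chi> h" if "h \<in> H" for h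
      using P_unique P_H that \<chi>' P_K by blast
  qed
qed

text \<open>On the cyclic group generated by \<open>a\<close>, the element \<open>a\<close> may be
  sent to a nontrivial root of unity. A maximal subgroup among those carrying a character nontrivial
  at \<open>a\<close> exists by finiteness, and \<open>extend_character\<close> forces it to be the
  whole group.\<close>

lemma character_separates:
  assumes A: "comm_group A" and fin: "finite (carrier A)" and a: "a \<in> carrier A" "a \<noteq> \<one>\<^bsub>A\<^esub>"
  obtains \<chi> where "\<chi> \<in> hom A complex_units" "\<chi> a \<noteq> 1"
proof -
  interpret A: comm_group A by fact
  define good where "good H \<longleftrightarrow> subgroup H A \<and> a \<in> H \<and>
      (\<exists>\<chi>\<in>hom (A\<lparr>carrier := H\<rparr>) complex_units. \<chi> a \<noteq> 1)" for H
  have "good (generate A {a})"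
  proof -
    define n where "n = A.ord a"
    have "n \<noteq> 1" "n \<noteq> 0"
      using a A.ord_eq_1 A.ord_ge_1[OF fin a(1)] by (auto simp: n_def)
    then have n: "1 < n" by simp
    define w where "w = cis (2 * pi / n)"
    have "w ^ n = 1"
      using n by (simp add: w_def DeMoivre)
    then obtain \<chi> where "\<chi> \<in> hom (A\<lparr>carrier := generate A {a}\<rparr>) complex_units" "\<chi> a = w"
      using A.hom_from_cyclic[OF CU.group_axioms a(1), of w] by (auto simp: w_def n_def)
    moreover have "w \<noteq> 1"
    proof
      have two_pi_neq: "2 * pi \<noteq> 0" by simp
      assume "w = 1"
      then have "cos (2 * pi / n) = 1"
        by (simp add: w_def complex_eq_iff)
      then obtain k :: int where k: "2 * pi / n = real_of_int k * 2 * pi"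
        unfolding cos_one_2pi_int by blast
      have "2 * pi * (real_of_int k * n) = (real_of_int k * 2 * pi) * n"
        by (simp only: mult_ac)
      also have "\<dots> = 2 * pi / n * n"
        by (simp only: k)
      also have "\<dots> = 2 * pi * 1"
        using n by simp
      finally have "real_of_int k * n = 1"
        by (simp only: mult_left_cancel[OF two_pi_neq])
      then have "k * int n = 1"
        by (metis of_int_1 of_int_eq_iff of_int_mult of_int_of_nat_eq)
      then show False
        using n by (simp add: zmult_eq_1_iff)
    qed
    ultimately show ?thesis
      using A.generate_is_subgroup[of "{a}"] a generate.incl[of a "{a}" A] by (auto simp: good_def)
  qed
  moreover have "finite {H. good H}"
    by (rule finite_subset[of _ "Pow (carrier A)"]) (use fin subgroup.subset in \<open>auto simp: good_def\<close>)
  ultimately obtain H where H: "good H" and max: "\<And>K. good K \<Longrightarrow> H \<subseteq> K \<Longrightarrow> K = H"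
    using finite_has_maximal[of "{H. good H}"] by auto
  obtain \<chi> where \<chi>: "\<chi> \<in> hom (A\<lparr>carrier := H\<rparr>) complex_units" "\<chi> a \<noteq> 1"
    and sub: "subgroup H A" and aH: "a \<in> H"
    using H by (auto simp: good_def)
  have "carrier A \<subseteq> H"
  proof
    fix x assume x: "x \<in> carrier A"
    obtain K \<chi>' where K: "subgroup K A" "H \<subseteq> K" "x \<in> K" "\<chi>' \<in> hom (A\<lparr>carrier := K\<rparr>) complex_units"
      "\<And>h. h \<in> H \<Longrightarrow> \<chi>' h = \<chi> h"
      using extend_character[OF A fin sub \<chi>(1) x] by blast
    then have "good K" using \<chi>(2) aH by (auto simp: good_def intro!: bexI[of _ \<chi>'])
    with max K show "x \<in> H" by blast
  qed
  then have "H = carrier A" using subgroup.subset[OF sub] by blast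
  then show thesis using \<chi> that by simp
qed

section \<open>Cocycles and extensions\<close>

text \<open>The pair \<open>(g, a)\<close> stands for \<open>a\<close> times a chosen lift of
  \<open>g\<close>. As \<open>c\<close> may be unnormalised, the lift of the identity of
  \<open>G\<close> need not be the identity, which explains the second component of the
  unit.\<close>

definition crossed_product ::
  "('g, 'h) monoid_scheme \<Rightarrow> ('m, 'n) monoid_scheme \<Rightarrow> ('g \<times> 'g \<Rightarrow> 'm) \<Rightarrow> ('g \<times> 'm) monoid" where
  "crossed_product G U c = \<lparr>carrier = carrier G \<times> carrier U,
     mult = \<lambda>(g, a) (h, b). (g \<otimes>\<^bsub>G\<^esub> h, a \<otimes>\<^bsub>U\<^esub> b \<otimes>\<^bsub>U\<^esub> c (g, h)),
     one = (\<one>\<^bsub>G\<^esub>, inv\<^bsub>U\<^esub> (c (\<one>\<^bsub>G\<^esub>, \<one>\<^bsub>G\<^esub>)))\<rparr>"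

lemma crossed_product_simps [simp]:
  "carrier (crossed_product G U c) = carrier G \<times> carrier U"
  "(g, a) \<otimes>\<^bsub>crossed_product G U c\<^esub> (h, b) = (g \<otimes>\<^bsub>G\<^esub> h, a \<otimes>\<^bsub>U\<^esub> b \<otimes>\<^bsub>U\<^esub> c (g, h))"
  "\<one>\<^bsub>crossed_product G U c\<^esub> = (\<one>\<^bsub>G\<^esub>, inv\<^bsub>U\<^esub> (c (\<one>\<^bsub>G\<^esub>, \<one>\<^bsub>G\<^esub>)))"
  by (simp_all add: crossed_product_def)

locale two_cocycle = G: group G + U: comm_group U
  for G :: "('g, 'h) monoid_scheme" and U :: "('m, 'n) monoid_scheme" +
  fixes c :: "'g \<times> 'g \<Rightarrow> 'm"
  assumes c: "c \<in> carrier (Z2 G U)"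
begin

abbreviation E where "E \<equiv> crossed_product G U c"

lemma c_closed [simp]: "g \<in> carrier G \<Longrightarrow> h \<in> carrier G \<Longrightarrow> c (g, h) \<in> carrier U"
  using c by (auto simp: Z2_def)

lemma cocycle: "g \<in> carrier G \<Longrightarrow> h \<in> carrier G \<Longrightarrow> k \<in> carrier G \<Longrightarrow>
    c (g, h) \<otimes>\<^bsub>U\<^esub> c (g \<otimes>\<^bsub>G\<^esub> h, k) = c (h, k) \<otimes>\<^bsub>U\<^esub> c (g, h \<otimes>\<^bsub>G\<^esub> k)"
  using c by (auto simp: Z2_def)

definition e :: 'm where "e = c (\<one>\<^bsub>G\<^esub>, \<one>\<^bsub>G\<^esub>)"

lemma e_closed [simp]: "e \<in> carrier U"
  by (simp add: e_def)

text \<open>The cocycle identity at two units and \<open>g\<close> makes even an unnormalised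
  cocycle constant along this axis; the other axis is analogous.\<close>

lemma c_one_left [simp]: "g \<in> carrier G \<Longrightarrow> c (\<one>\<^bsub>G\<^esub>, g) = e"
  using cocycle[of "\<one>\<^bsub>G\<^esub>" "\<one>\<^bsub>G\<^esub>" g] by (simp add: e_def U.m_comm)

lemma c_one_right [simp]: "g \<in> carrier G \<Longrightarrow> c (g, \<one>\<^bsub>G\<^esub>) = e"
  using cocycle[of g "\<one>\<^bsub>G\<^esub>" "\<one>\<^bsub>G\<^esub>"] by simp

lemma group_crossed_product: "group E"
proof (rule groupI)
  fix x y z assume "x \<in> carrier E" "y \<in> carrier E" "z \<in> carrier E"
  then obtain g a h b k d where x: "x = (g, a)" "y = (h, b)" "z = (k, d)"
    and GU: "g \<in> carrier G" "a \<in> carrier U" "h \<in> carrier G" "b \<in> carrier U"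
      "k \<in> carrier G" "d \<in> carrier U"
    by (cases x; cases y; cases z) auto
  have "a \<otimes>\<^bsub>U\<^esub> b \<otimes>\<^bsub>U\<^esub> c (g, h) \<otimes>\<^bsub>U\<^esub> d \<otimes>\<^bsub>U\<^esub> c (g \<otimes>\<^bsub>G\<^esub> h, k)
      = a \<otimes>\<^bsub>U\<^esub> b \<otimes>\<^bsub>U\<^esub> d \<otimes>\<^bsub>U\<^esub> (c (g, h) \<otimes>\<^bsub>U\<^esub> c (g \<otimes>\<^bsub>G\<^esub> h, k))"
    using GU by (simp add: U.m_ac)
  also have "\<dots> = a \<otimes>\<^bsub>U\<^esub> (b \<otimes>\<^bsub>U\<^esub> d \<otimes>\<^bsub>U\<^esub> c (h, k)) \<otimes>\<^bsub>U\<^esub> c (g, h \<otimes>\<^bsub>G\<^esub> k)"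
    using GU by (simp add: cocycle U.m_ac)
  finally show "x \<otimes>\<^bsub>E\<^esub> y \<otimes>\<^bsub>E\<^esub> z = x \<otimes>\<^bsub>E\<^esub> (y \<otimes>\<^bsub>E\<^esub> z)"
    using GU by (simp add: x G.m_assoc)
next
  fix x assume "x \<in> carrier E"
  then obtain g a where x: "x = (g, a)" and GU: "g \<in> carrier G" "a \<in> carrier U"
    by (cases x) auto
  define b where "b = inv\<^bsub>U\<^esub> e \<otimes>\<^bsub>U\<^esub> inv\<^bsub>U\<^esub> (a \<otimes>\<^bsub>U\<^esub> c (inv\<^bsub>G\<^esub> g, g))"
  have "b \<otimes>\<^bsub>U\<^esub> a \<otimes>\<^bsub>U\<^esub> c (inv\<^bsub>G\<^esub> g, g) = inv\<^bsub>U\<^esub> e"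
    using GU by (simp add: b_def U.m_assoc del: U.inv_mult_group)
  moreover have "b \<in> carrier U"
    using GU by (simp add: b_def)
  ultimately show "\<exists>y\<in>carrier E. y \<otimes>\<^bsub>E\<^esub> x = \<one>\<^bsub>E\<^esub>"
    using GU by (intro bexI[of _ "(inv\<^bsub>G\<^esub> g, b)"]) (auto simp: x)
  show "\<one>\<^bsub>E\<^esub> \<otimes>\<^bsub>E\<^esub> x = x"
    using GU U.inv_solve_right'[of a a e] by (simp add: x U.m_ac)
qed auto

sublocale E: group E
  by (rule group_crossed_product)

lemma fst_hom: "fst \<in> hom E G"
  by (auto simp: hom_def)

text \<open>The factor \<open>inv e\<close> compensates for the value of the cocycle at the units.
  With it, \<open>emb\<close> is a homomorphism and multiplication by \<open>emb a\<close> just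
  multiplies the second component by \<open>a\<close>.\<close>

definition emb :: "'m \<Rightarrow> 'g \<times> 'm" where
  "emb a = (\<one>\<^bsub>G\<^esub>, a \<otimes>\<^bsub>U\<^esub> inv\<^bsub>U\<^esub> e)"

lemma emb_closed [simp]: "a \<in> carrier U \<Longrightarrow> emb a \<in> carrier E"
  by (simp add: emb_def)

lemma emb_mult: "a \<in> carrier U \<Longrightarrow> g \<in> carrier G \<Longrightarrow> b \<in> carrier U \<Longrightarrow>
    emb a \<otimes>\<^bsub>E\<^esub> (g, b) = (g, a \<otimes>\<^bsub>U\<^esub> b)"
  using U.inv_solve_right'[of b b e] by (simp add: emb_def U.m_ac)

lemma mult_emb: "a \<in> carrier U \<Longrightarrow> g \<in> carrier G \<Longrightarrow> b \<in> carrier U \<Longrightarrow>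
    (g, b) \<otimes>\<^bsub>E\<^esub> emb a = (g, a \<otimes>\<^bsub>U\<^esub> b)"
  using U.inv_solve_right'[of b b e] by (simp add: emb_def U.m_ac)

lemma emb_central: "a \<in> carrier U \<Longrightarrow> x \<in> carrier E \<Longrightarrow> emb a \<otimes>\<^bsub>E\<^esub> x = x \<otimes>\<^bsub>E\<^esub> emb a"
  by (cases x) (auto simp: emb_mult mult_emb simp del: crossed_product_simps(2))

lemma emb_hom: "emb \<in> hom U E"
  using emb_mult by (auto simp: hom_def emb_def U.m_assoc simp del: crossed_product_simps(2))

lemma emb_inject: "a \<in> carrier U \<Longrightarrow> b \<in> carrier U \<Longrightarrow> emb a = emb b \<Longrightarrow> a = b"
  by (simp add: emb_def)

lemma embE:
  assumes "x \<in> carrier E" "fst x = \<one>\<^bsub>G\<^esub>"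
  obtains a where "a \<in> carrier U" "x = emb a"
proof
  show "snd x \<otimes>\<^bsub>U\<^esub> e \<in> carrier U" "x = emb (snd x \<otimes>\<^bsub>U\<^esub> e)"
    using assms by (cases x; simp add: emb_def U.m_assoc)+
qed

lemma emb_translate:
  assumes "x \<in> carrier E" "y \<in> carrier E" "fst x = fst y"
  obtains a where "a \<in> carrier U" "x = emb a \<otimes>\<^bsub>E\<^esub> y"
proof
  show "snd x \<otimes>\<^bsub>U\<^esub> inv\<^bsub>U\<^esub> (snd y) \<in> carrier U"
    "x = emb (snd x \<otimes>\<^bsub>U\<^esub> inv\<^bsub>U\<^esub> (snd y)) \<otimes>\<^bsub>E\<^esub> y"
    using assms by (cases x; cases y; auto simp: emb_mult U.m_assoc simp del: crossed_product_simps(2))+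
qed

text \<open>By centrality, correcting a lift by \<open>a\<close> changes its \<open>n\<close>-th
  power by \<open>a\<close> to the \<open>n\<close>. This serves both to adjust the order of a lift
  and to recognise that a correction is a root of unity.\<close>

lemma pow_emb_mult:
  assumes "a \<in> carrier U" "x \<in> carrier E"
  shows "(emb a \<otimes>\<^bsub>E\<^esub> x) [^]\<^bsub>E\<^esub> (n::nat) = emb (a [^]\<^bsub>U\<^esub> n) \<otimes>\<^bsub>E\<^esub> x [^]\<^bsub>E\<^esub> n"
proof -
  have "emb a [^]\<^bsub>E\<^esub> n = emb (a [^]\<^bsub>U\<^esub> n)"
    using hom_nat_pow[OF emb_hom assms(1) U.group_axioms E.group_axioms] by simp
  then show ?thesis
    using E.pow_mult_distrib[OF emb_central[OF assms] emb_closed[OF assms(1)] assms(2)] by simp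
qed

end

section \<open>Central extensions, sections and homomorphisms over the base group\<close>

locale central_extension = E: group E + G: group G
  for E :: "('e, 'f) monoid_scheme" and G :: "('g, 'h) monoid_scheme" +
  fixes p :: "'e \<Rightarrow> 'g"
  assumes epi: "p \<in> epi E G"
    and central: "\<And>a x. a \<in> kernel E G p \<Longrightarrow> x \<in> carrier E \<Longrightarrow> a \<otimes>\<^bsub>E\<^esub> x = x \<otimes>\<^bsub>E\<^esub> a"
begin

sublocale p: group_hom E G p
  using epi by unfold_locales (simp add: epi_def)

abbreviation A where "A \<equiv> E\<lparr>carrier := kernel E G p\<rparr>"

lemma comm_group_kernel: "comm_group A"
proof (rule group.group_comm_groupI)
  show "group A"
    by (rule E.subgroup_imp_group[OF p.subgroup_kernel])
qed (auto intro: central simp: kernel_def)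

lemma kernel_carrier: "a \<in> kernel E G p \<Longrightarrow> a \<in> carrier E"
  by (simp add: kernel_def)

lemma exists_section:
  obtains s where "s \<in> carrier G \<rightarrow> carrier E" "\<And>g. g \<in> carrier G \<Longrightarrow> p (s g) = g"
proof -
  have "\<forall>g\<in>carrier G. \<exists>x\<in>carrier E. p x = g"
    using epi by (auto simp: epi_def image_iff) (metis imageE)
  then show thesis using that by (metis Pi_I)
qed

end

locale sectioned_extension = central_extension +
  fixes s :: "'c \<Rightarrow> 'a"
  assumes s_closed: "s \<in> carrier G \<rightarrow> carrier E"
    and p_s [simp]: "g \<in> carrier G \<Longrightarrow> p (s g) = g"
begin

abbreviation \<gamma> where "\<gamma> \<equiv> factor_set G E s"

lemma s_carrier [simp]: "g \<in> carrier G \<Longrightarrow> s g \<in> carrier E"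
  using s_closed by auto

lemma \<gamma>_eq: "g \<in> carrier G \<Longrightarrow> h \<in> carrier G \<Longrightarrow>
    \<gamma> (g, h) = s g \<otimes>\<^bsub>E\<^esub> s h \<otimes>\<^bsub>E\<^esub> inv\<^bsub>E\<^esub> (s (g \<otimes>\<^bsub>G\<^esub> h))"
  by (simp add: factor_set_def)

lemma \<gamma>_kernel [simp]: "g \<in> carrier G \<Longrightarrow> h \<in> carrier G \<Longrightarrow> \<gamma> (g, h) \<in> kernel E G p"
  by (simp add: \<gamma>_eq kernel_def)

lemma \<gamma>_carrier [simp]: "g \<in> carrier G \<Longrightarrow> h \<in> carrier G \<Longrightarrow> \<gamma> (g, h) \<in> carrier E"
  by (simp add: kernel_carrier)

lemma s_mult: "g \<in> carrier G \<Longrightarrow> h \<in> carrier G \<Longrightarrow> s g \<otimes>\<^bsub>E\<^esub> s h = \<gamma> (g, h) \<otimes>\<^bsub>E\<^esub> s (g \<otimes>\<^bsub>G\<^esub> h)"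
  by (simp add: \<gamma>_eq E.m_assoc)

text \<open>Both sides are the kernel factor obtained from the product of \<open>s g\<close>,
  \<open>s h\<close> and \<open>s k\<close> under its two bracketings, where centrality lets kernel
  factors move to the left.\<close>

lemma \<gamma>_cocycle:
  assumes "g \<in> carrier G" "h \<in> carrier G" "k \<in> carrier G"
  shows "\<gamma> (g, h) \<otimes>\<^bsub>E\<^esub> \<gamma> (g \<otimes>\<^bsub>G\<^esub> h, k) = \<gamma> (h, k) \<otimes>\<^bsub>E\<^esub> \<gamma> (g, h \<otimes>\<^bsub>G\<^esub> k)"
proof -
  have "\<gamma> (g, h) \<otimes>\<^bsub>E\<^esub> \<gamma> (g \<otimes>\<^bsub>G\<^esub> h, k) \<otimes>\<^bsub>E\<^esub> s (g \<otimes>\<^bsub>G\<^esub> h \<otimes>\<^bsub>G\<^esub> k) = s g \<otimes>\<^bsub>E\<^esub> s h \<otimes>\<^bsub>E\<^esub> s k"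
    using assms s_mult[of "g \<otimes>\<^bsub>G\<^esub> h" k] by (simp add: s_mult[of g h] E.m_assoc)
  also have "\<dots> = s g \<otimes>\<^bsub>E\<^esub> (\<gamma> (h, k) \<otimes>\<^bsub>E\<^esub> s (h \<otimes>\<^bsub>G\<^esub> k))"
    using assms by (simp add: E.m_assoc s_mult[of h k])
  also have "\<dots> = \<gamma> (h, k) \<otimes>\<^bsub>E\<^esub> (s g \<otimes>\<^bsub>E\<^esub> s (h \<otimes>\<^bsub>G\<^esub> k))"
    using assms central[OF \<gamma>_kernel[of h k], of "s g"] by (simp flip: E.m_assoc)
  also have "\<dots> = \<gamma> (h, k) \<otimes>\<^bsub>E\<^esub> \<gamma> (g, h \<otimes>\<^bsub>G\<^esub> k) \<otimes>\<^bsub>E\<^esub> s (g \<otimes>\<^bsub>G\<^esub> h \<otimes>\<^bsub>G\<^esub> k)"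
    using assms by (simp add: s_mult E.m_assoc G.m_assoc)
  finally show ?thesis
    using assms by simp
qed

context
  fixes U :: "('m, 'n) monoid_scheme" and l
  assumes U: "comm_group U" and l: "l \<in> hom A U"
begin

lemma l_closed: "a \<in> kernel E G p \<Longrightarrow> l a \<in> carrier U"
  using l by (auto simp: hom_def)

lemma l_mult: "a \<in> kernel E G p \<Longrightarrow> b \<in> kernel E G p \<Longrightarrow> l (a \<otimes>\<^bsub>E\<^esub> b) = l a \<otimes>\<^bsub>U\<^esub> l b"
  using l by (auto simp: hom_def)

lemma image_cocycle: "restrict (l \<circ> \<gamma>) (carrier G \<times> carrier G) \<in> carrier (Z2 G U)"
  by (auto simp: Z2_def l_closed \<gamma>_cocycle simp flip: l_mult)

text \<open>Every \<open>x\<close> is an element of the kernel times \<open>s (p x)\<close>.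
  Applying \<open>l\<close> to the kernel part respects products up to the cocycle
  \<open>l \<circ> \<gamma>\<close>, and the cochain \<open>t\<close> turns that cocycle into
  \<open>c\<close>.\<close>

lemma hom_crossed_product:
  assumes c: "two_cocycle G U c" and t: "t \<in> carrier G \<rightarrow> carrier U"
    and lt: "\<And>g h. g \<in> carrier G \<Longrightarrow> h \<in> carrier G \<Longrightarrow> l (\<gamma> (g, h)) = factor_set G U t (g, h) \<otimes>\<^bsub>U\<^esub> c (g, h)"
  shows "(\<lambda>x. (p x, l (x \<otimes>\<^bsub>E\<^esub> inv\<^bsub>E\<^esub> (s (p x))) \<otimes>\<^bsub>U\<^esub> t (p x))) \<in> hom E (crossed_product G U c)"
proof (rule homI)
  interpret c: two_cocycle G U c by fact
  define r where "r x = x \<otimes>\<^bsub>E\<^esub> inv\<^bsub>E\<^esub> (s (p x))" for x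
  have r: "r x \<in> kernel E G p" if "x \<in> carrier E" for x
    using that by (simp add: r_def kernel_def)
  have tc: "t g \<in> carrier U" if "g \<in> carrier G" for g
    using t that by auto
  have x_eq: "x = r x \<otimes>\<^bsub>E\<^esub> s (p x)" if "x \<in> carrier E" for x
    using that by (simp add: r_def E.m_assoc)
  have rc: "r x \<in> carrier E" if "x \<in> carrier E" for x
    using r[OF that] by (rule kernel_carrier)
  fix x assume x: "x \<in> carrier E"
  show "(p x, l (x \<otimes>\<^bsub>E\<^esub> inv\<^bsub>E\<^esub> (s (p x))) \<otimes>\<^bsub>U\<^esub> t (p x)) \<in> carrier (crossed_product G U c)"
    using x r[OF x] by (simp add: l_closed tc flip: r_def)
  fix y assume y: "y \<in> carrier E"
  \<comment> \<open>The kernel parts multiply up to \<gamma>, since the kernel part of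
    \<open>y\<close> commutes with \<open>s (p x)\<close>.\<close>
  have r_mult: "r (x \<otimes>\<^bsub>E\<^esub> y) = r x \<otimes>\<^bsub>E\<^esub> r y \<otimes>\<^bsub>E\<^esub> \<gamma> (p x, p y)"
  proof -
    have "x \<otimes>\<^bsub>E\<^esub> y = r x \<otimes>\<^bsub>E\<^esub> s (p x) \<otimes>\<^bsub>E\<^esub> (r y \<otimes>\<^bsub>E\<^esub> s (p y))"
      using x_eq[OF x] x_eq[OF y] by simp
    also have "\<dots> = r x \<otimes>\<^bsub>E\<^esub> (s (p x) \<otimes>\<^bsub>E\<^esub> r y) \<otimes>\<^bsub>E\<^esub> s (p y)"
      using x y rc by (simp add: E.m_assoc)
    also have "\<dots> = r x \<otimes>\<^bsub>E\<^esub> r y \<otimes>\<^bsub>E\<^esub> (s (p x) \<otimes>\<^bsub>E\<^esub> s (p y))"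
    proof -
      have "s (p x) \<otimes>\<^bsub>E\<^esub> r y = r y \<otimes>\<^bsub>E\<^esub> s (p x)"
        using x central[OF r[OF y], of "s (p x)"] by simp
      then show ?thesis using x y rc by (simp add: E.m_assoc)
    qed
    finally have eq: "x \<otimes>\<^bsub>E\<^esub> y = r x \<otimes>\<^bsub>E\<^esub> r y \<otimes>\<^bsub>E\<^esub> (s (p x) \<otimes>\<^bsub>E\<^esub> s (p y))" .
    have "r (x \<otimes>\<^bsub>E\<^esub> y) = (x \<otimes>\<^bsub>E\<^esub> y) \<otimes>\<^bsub>E\<^esub> inv\<^bsub>E\<^esub> (s (p x \<otimes>\<^bsub>G\<^esub> p y))"
      using x y by (simp add: r_def)
    also have "\<dots> = r x \<otimes>\<^bsub>E\<^esub> r y \<otimes>\<^bsub>E\<^esub> \<gamma> (p x, p y)"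
      using x y rc by (simp only: eq) (simp add: \<gamma>_eq E.m_assoc)
    finally show ?thesis .
  qed
  have "l (r (x \<otimes>\<^bsub>E\<^esub> y)) = l (r x) \<otimes>\<^bsub>U\<^esub> l (r y) \<otimes>\<^bsub>U\<^esub> l (\<gamma> (p x, p y))"
    using x y r p.subgroup_kernel by (simp add: r_mult l_mult subgroup.m_closed)
  then have "l (r (x \<otimes>\<^bsub>E\<^esub> y)) \<otimes>\<^bsub>U\<^esub> t (p x \<otimes>\<^bsub>G\<^esub> p y) =
      l (r x) \<otimes>\<^bsub>U\<^esub> l (r y) \<otimes>\<^bsub>U\<^esub> (t (p x) \<otimes>\<^bsub>U\<^esub> t (p y) \<otimes>\<^bsub>U\<^esub> inv\<^bsub>U\<^esub> (t (p x \<otimes>\<^bsub>G\<^esub> p y)) \<otimes>\<^bsub>U\<^esub> c (p x, p y))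
        \<otimes>\<^bsub>U\<^esub> t (p x \<otimes>\<^bsub>G\<^esub> p y)"
    using x y by (simp add: lt) (simp add: factor_set_def)
  also have "\<dots> = l (r x) \<otimes>\<^bsub>U\<^esub> l (r y) \<otimes>\<^bsub>U\<^esub> (t (p x) \<otimes>\<^bsub>U\<^esub> t (p y) \<otimes>\<^bsub>U\<^esub> c (p x, p y))
      \<otimes>\<^bsub>U\<^esub> (inv\<^bsub>U\<^esub> (t (p x \<otimes>\<^bsub>G\<^esub> p y)) \<otimes>\<^bsub>U\<^esub> t (p x \<otimes>\<^bsub>G\<^esub> p y))"
    using x y r l_closed tc by (simp add: c.U.m_ac del: c.U.l_inv c.U.r_inv)
  also have "\<dots> = l (r x) \<otimes>\<^bsub>U\<^esub> t (p x) \<otimes>\<^bsub>U\<^esub> (l (r y) \<otimes>\<^bsub>U\<^esub> t (p y)) \<otimes>\<^bsub>U\<^esub> c (p x, p y)"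
    using x y r l_closed tc by (simp add: c.U.m_ac)
  finally show "(p (x \<otimes>\<^bsub>E\<^esub> y), l (x \<otimes>\<^bsub>E\<^esub> y \<otimes>\<^bsub>E\<^esub> inv\<^bsub>E\<^esub> (s (p (x \<otimes>\<^bsub>E\<^esub> y)))) \<otimes>\<^bsub>U\<^esub> t (p (x \<otimes>\<^bsub>E\<^esub> y))) =
      (p x, l (x \<otimes>\<^bsub>E\<^esub> inv\<^bsub>E\<^esub> (s (p x))) \<otimes>\<^bsub>U\<^esub> t (p x)) \<otimes>\<^bsub>crossed_product G U c\<^esub>
      (p y, l (y \<otimes>\<^bsub>E\<^esub> inv\<^bsub>E\<^esub> (s (p y))) \<otimes>\<^bsub>U\<^esub> t (p y))"
    using x y by (simp add: r_def)
qed

end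

text \<open>Converse of \<open>hom_crossed_product\<close>. On the kernel, \<Phi> takes values over
  the identity, that is in the image of \<open>emb\<close>, which yields \<open>l\<close>; on the
  section its second component is \<open>t\<close>. The relation is the image under \<Phi> of the
  rule for \<open>s g\<close> times \<open>s h\<close>.\<close>

lemma character_of_hom_crossed_product:
  assumes c: "two_cocycle G U c" and \<Phi>: "\<Phi> \<in> hom E (crossed_product G U c)"
    and fst_\<Phi>: "\<And>x. x \<in> carrier E \<Longrightarrow> fst (\<Phi> x) = p x"
  obtains l t where "l \<in> hom A U" "t \<in> carrier G \<rightarrow> carrier U"
    "\<And>g h. g \<in> carrier G \<Longrightarrow> h \<in> carrier G \<Longrightarrow> l (\<gamma> (g, h)) = factor_set G U t (g, h) \<otimes>\<^bsub>U\<^esub> c (g, h)"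
proof -
  interpret c: two_cocycle G U c by fact
  have \<Phi>c: "\<Phi> x \<in> carrier c.E" if "x \<in> carrier E" for x
    using \<Phi> that by (auto simp: hom_def)
  have \<Phi>m: "\<Phi> (x \<otimes>\<^bsub>E\<^esub> y) = \<Phi> x \<otimes>\<^bsub>c.E\<^esub> \<Phi> y" if "x \<in> carrier E" "y \<in> carrier E" for x y
    using \<Phi> that by (auto simp: hom_def)
  have "\<exists>u. u \<in> carrier U \<and> \<Phi> a = c.emb u" if "a \<in> kernel E G p" for a
  proof -
    have "a \<in> carrier E" "p a = \<one>\<^bsub>G\<^esub>" using that by (auto simp: kernel_def)
    then show ?thesis using c.embE[OF \<Phi>c] fst_\<Phi> by metis
  qed
  then obtain l where l: "\<And>a. a \<in> kernel E G p \<Longrightarrow> l a \<in> carrier U \<and> \<Phi> a = c.emb (l a)"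
    by metis
  define t where "t g = snd (\<Phi> (s g))" for g
  have \<Phi>s: "\<Phi> (s g) = (g, t g)" if "g \<in> carrier G" for g
    using fst_\<Phi>[of "s g"] that by (simp add: t_def prod_eq_iff)
  have t: "t g \<in> carrier U" if "g \<in> carrier G" for g
    using \<Phi>c[of "s g"] \<Phi>s[OF that] that by simp
  show thesis
  proof
    show "l \<in> hom A U"
    proof (rule homI; simp)
      fix a b assume ab: "a \<in> kernel E G p" "b \<in> kernel E G p"
      then have m: "a \<otimes>\<^bsub>E\<^esub> b \<in> kernel E G p"
        using p.subgroup_kernel by (simp add: subgroup.m_closed)
      have "c.emb (l (a \<otimes>\<^bsub>E\<^esub> b)) = \<Phi> a \<otimes>\<^bsub>c.E\<^esub> \<Phi> b"
        using l[OF m] \<Phi>m ab kernel_carrier by simp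
      also have "\<dots> = c.emb (l a \<otimes>\<^bsub>U\<^esub> l b)"
        using c.emb_hom l ab by (simp add: hom_def del: crossed_product_simps)
      finally show "l (a \<otimes>\<^bsub>E\<^esub> b) = l a \<otimes>\<^bsub>U\<^esub> l b"
        using l ab m by (intro c.emb_inject) auto
    qed (use l in auto)
    show "t \<in> carrier G \<rightarrow> carrier U" using t by auto
    fix g h assume gh: "g \<in> carrier G" "h \<in> carrier G"
    note lc = l[OF \<gamma>_kernel[OF gh]]
    have "\<Phi> (s g) \<otimes>\<^bsub>c.E\<^esub> \<Phi> (s h) = \<Phi> (\<gamma> (g, h)) \<otimes>\<^bsub>c.E\<^esub> \<Phi> (s (g \<otimes>\<^bsub>G\<^esub> h))"
      using gh s_mult[OF gh] by (simp flip: \<Phi>m)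
    then have "(g, t g) \<otimes>\<^bsub>c.E\<^esub> (h, t h) = c.emb (l (\<gamma> (g, h))) \<otimes>\<^bsub>c.E\<^esub> (g \<otimes>\<^bsub>G\<^esub> h, t (g \<otimes>\<^bsub>G\<^esub> h))"
      using lc gh by (simp add: \<Phi>s del: crossed_product_simps)
    then have "t g \<otimes>\<^bsub>U\<^esub> t h \<otimes>\<^bsub>U\<^esub> c (g, h) = l (\<gamma> (g, h)) \<otimes>\<^bsub>U\<^esub> t (g \<otimes>\<^bsub>G\<^esub> h)"
      using c.emb_mult lc gh t by simp
    then have "l (\<gamma> (g, h)) = t g \<otimes>\<^bsub>U\<^esub> t h \<otimes>\<^bsub>U\<^esub> c (g, h) \<otimes>\<^bsub>U\<^esub> inv\<^bsub>U\<^esub> (t (g \<otimes>\<^bsub>G\<^esub> h))"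
      using lc gh t by (intro c.U.inv_solve_right[THEN iffD2]) auto
    then show "l (\<gamma> (g, h)) = factor_set G U t (g, h) \<otimes>\<^bsub>U\<^esub> c (g, h)"
      using gh t by (simp add: factor_set_def c.U.m_ac)
  qed
qed

end

section \<open>Cohomology classes and covers\<close>

lemma cohomology_class_mem_H2: "c \<in> carrier (Z2 G U) \<Longrightarrow> cohomology_class G U c \<in> carrier (H2 G U)"
  by (auto simp: H2_def cohomology_class_def carrier_FactGroup)

lemma H2_classE:
  assumes "X \<in> carrier (H2 G U)"
  obtains c where "c \<in> carrier (Z2 G U)" "X = cohomology_class G U c"
  using assms by (auto simp: H2_def cohomology_class_def carrier_FactGroup)

lemma mult_Z2 [simp]: "b \<otimes>\<^bsub>Z2 G U\<^esub> c = (\<lambda>x\<in>carrier G \<times> carrier G. b x \<otimes>\<^bsub>U\<^esub> c x)"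
  by (simp add: Z2_def)

lemma factor_set_mult:
  assumes "group G" "comm_group U" "t \<in> carrier G \<rightarrow> carrier U" "u \<in> carrier G \<rightarrow> carrier U"
    and g: "g \<in> carrier G" "h \<in> carrier G"
  shows "factor_set G U (\<lambda>x. t x \<otimes>\<^bsub>U\<^esub> u x) (g, h) = factor_set G U t (g, h) \<otimes>\<^bsub>U\<^esub> factor_set G U u (g, h)"
proof -
  interpret G: group G by fact
  interpret U: comm_group U by fact
  have "t x \<in> carrier U" "u x \<in> carrier U" if "x \<in> carrier G" for x
    using assms that by auto
  then show ?thesis
    using g by (simp add: factor_set_def U.inv_mult U.m_ac)
qed

text \<open>A class is the explicit set of products of its representative with coboundaries. One
  inclusion comes from multiplying cochains, the other from inverting the cochain
  \<open>t\<close>.\<close>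

lemma cohomology_class_eq_iff:
  assumes G: "group G" and U: "comm_group U"
    and b: "b \<in> carrier (Z2 G U)" and c: "c \<in> carrier (Z2 G U)"
  shows "cohomology_class G U b = cohomology_class G U c \<longleftrightarrow>
    (\<exists>t\<in>carrier G \<rightarrow> carrier U. \<forall>g\<in>carrier G. \<forall>h\<in>carrier G.
       b (g, h) = factor_set G U t (g, h) \<otimes>\<^bsub>U\<^esub> c (g, h))" (is "?L \<longleftrightarrow> ?R b c")
proof -
  interpret G: group G by fact
  interpret U: comm_group U by fact
  have class_def: "cohomology_class G U c =
      {(\<lambda>x\<in>carrier G \<times> carrier G. factor_set G U t x \<otimes>\<^bsub>U\<^esub> c x) | t. t \<in> carrier G \<rightarrow> carrier U}" for c
    by (auto simp: cohomology_class_def r_coset_def B2_def)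
  have fs: "factor_set G U t (g, h) \<in> carrier U"
    if "t \<in> carrier G \<rightarrow> carrier U" "g \<in> carrier G" "h \<in> carrier G" for t g h
  proof -
    have "t g \<in> carrier U" "t h \<in> carrier U" "t (g \<otimes>\<^bsub>G\<^esub> h) \<in> carrier U" using that by auto
    then show ?thesis using that by (simp add: factor_set_def)
  qed
  have val: "c (g, h) \<in> carrier U" if "c \<in> carrier (Z2 G U)" "g \<in> carrier G" "h \<in> carrier G" for c g h
    using that by (auto simp: Z2_def)
  have sub: "cohomology_class G U b \<subseteq> cohomology_class G U c"
    if R: "?R b c" and bc: "b \<in> carrier (Z2 G U)" "c \<in> carrier (Z2 G U)" for b c
  proof
    fix x assume "x \<in> cohomology_class G U b"
    then obtain u where u: "u \<in> carrier G \<rightarrow> carrier U"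
      and x: "x = (\<lambda>z\<in>carrier G \<times> carrier G. factor_set G U u z \<otimes>\<^bsub>U\<^esub> b z)"
      by (auto simp: class_def)
    obtain t where t: "t \<in> carrier G \<rightarrow> carrier U"
      and bt: "\<And>g h. g \<in> carrier G \<Longrightarrow> h \<in> carrier G \<Longrightarrow> b (g, h) = factor_set G U t (g, h) \<otimes>\<^bsub>U\<^esub> c (g, h)"
      using R by auto
    have "(\<lambda>g. u g \<otimes>\<^bsub>U\<^esub> t g) \<in> carrier G \<rightarrow> carrier U"
      using u t by auto
    moreover have "x = (\<lambda>z\<in>carrier G \<times> carrier G. factor_set G U (\<lambda>g. u g \<otimes>\<^bsub>U\<^esub> t g) z \<otimes>\<^bsub>U\<^esub> c z)"
      unfolding x using u t bc
      by (auto simp: bt factor_set_mult[OF G U] U.m_assoc fs val intro!: restrict_ext)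
    ultimately show "x \<in> cohomology_class G U c"
      unfolding class_def by blast
  qed
  have sym: "?R c b" if R: "?R b c" and bc: "b \<in> carrier (Z2 G U)" "c \<in> carrier (Z2 G U)" for b c
  proof -
    obtain t where t: "t \<in> carrier G \<rightarrow> carrier U"
      and bt: "\<And>g h. g \<in> carrier G \<Longrightarrow> h \<in> carrier G \<Longrightarrow> b (g, h) = factor_set G U t (g, h) \<otimes>\<^bsub>U\<^esub> c (g, h)"
      using R by auto
    have it: "(\<lambda>g. inv\<^bsub>U\<^esub> (t g)) \<in> carrier G \<rightarrow> carrier U"
      using t by auto
    have "factor_set G U (\<lambda>g. inv\<^bsub>U\<^esub> (t g)) (g, h) \<otimes>\<^bsub>U\<^esub> factor_set G U t (g, h) = \<one>\<^bsub>U\<^esub>"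
      if "g \<in> carrier G" "h \<in> carrier G" for g h
    proof -
      have "t g \<in> carrier U" "t h \<in> carrier U" "t (g \<otimes>\<^bsub>G\<^esub> h) \<in> carrier U" using t that by auto
      then show ?thesis
        using that t by (simp add: factor_set_mult[OF G U it t, symmetric]) (simp add: factor_set_def)
    qed
    then have "c (g, h) = factor_set G U (\<lambda>g. inv\<^bsub>U\<^esub> (t g)) (g, h) \<otimes>\<^bsub>U\<^esub> b (g, h)"
      if "g \<in> carrier G" "h \<in> carrier G" for g h
      using that fs[OF it that] fs[OF t that] val bc by (simp add: bt flip: U.m_assoc)
    with it show ?thesis by blast
  qed
  show ?thesis
  proof
    assume ?L
    \<comment> \<open>The trivial cochain shows that \<open>b\<close> lies in its own class;
      extensionality of \<open>b\<close> makes this an equality of functions.\<close>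
    have b_eq: "b = (\<lambda>x\<in>carrier G \<times> carrier G. factor_set G U (\<lambda>_. \<one>\<^bsub>U\<^esub>) x \<otimes>\<^bsub>U\<^esub> b x)"
    proof (rule extensionalityI[of b "carrier G \<times> carrier G"])
      show "b \<in> extensional (carrier G \<times> carrier G)"
        using b by (auto simp: Z2_def PiE_def)
    qed (use val[OF b] in \<open>auto simp: factor_set_def\<close>)
    have "b \<in> cohomology_class G U b"
      unfolding class_def using b_eq by auto
    then have "b \<in> cohomology_class G U c" using \<open>?L\<close> by simp
    then obtain t where "t \<in> carrier G \<rightarrow> carrier U"
      "b = (\<lambda>x\<in>carrier G \<times> carrier G. factor_set G U t x \<otimes>\<^bsub>U\<^esub> c x)"
      by (auto simp: class_def)
    then show "?R b c" by auto
  next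
    assume R: "?R b c"
    show ?L
      using sub[OF R b c] sub[OF sym[OF R b c] c b] by (rule subset_antisym)
  qed
qed

lemma two_cocycle_complex_units:
  "group G \<Longrightarrow> c \<in> carrier (Z2 G complex_units) \<Longrightarrow> two_cocycle G complex_units c"
  by (simp add: two_cocycle_def two_cocycle_axioms_def comm_group_complex_units)

lemma finite_central_extension_iff:
  "finite_central_extension E G p \<longleftrightarrow> central_extension E G p \<and> finite (carrier E)"
  by (auto simp: finite_central_extension_def central_extension_def central_extension_axioms_def)

text \<open>Classes of \<open>l \<circ> \<gamma>\<close> and \<open>c\<close> agree when the two
  cocycles differ by the coboundary of some \<open>t\<close>, and such a pair of \<open>l\<close>
  and \<open>t\<close> yields, and comes from, a homomorphism over \<open>G\<close>. This form of
  the condition is free of sections of \<open>E\<close>.\<close>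

lemma is_cover_iff:
  "is_cover E G p \<longleftrightarrow> finite_central_extension E G p \<and>
     (\<forall>c\<in>carrier (Z2 G complex_units). \<exists>\<Phi>\<in>hom E (crossed_product G complex_units c).
        \<forall>x\<in>carrier E. fst (\<Phi> x) = p x)"
proof -
  let ?C = complex_units
  have "(\<forall>\<gamma>\<in>extension_cocycles E G p. eta G \<gamma> ` hom (E\<lparr>carrier := kernel E G p\<rparr>) ?C = carrier (H2 G ?C))
    \<longleftrightarrow> (\<forall>c\<in>carrier (Z2 G ?C). \<exists>\<Phi>\<in>hom E (crossed_product G ?C c). \<forall>x\<in>carrier E. fst (\<Phi> x) = p x)"
    (is "?L \<longleftrightarrow> ?R") if fce: "finite_central_extension E G p"
  proof -
    interpret central_extension E G p
      using fce by (simp add: finite_central_extension_iff)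
    show ?thesis
    proof
      assume L: ?L
      obtain s where s: "s \<in> carrier G \<rightarrow> carrier E" "\<And>g. g \<in> carrier G \<Longrightarrow> p (s g) = g"
        using exists_section by blast
      interpret sectioned_extension E G p s
        by unfold_locales (use s in auto)
      show ?R
      proof
        fix c assume c: "c \<in> carrier (Z2 G ?C)"
        have "factor_set G E s \<in> extension_cocycles E G p"
          using s by (auto simp: extension_cocycles_def)
        then have "cohomology_class G ?C c \<in> eta G \<gamma> ` hom A ?C"
          using L cohomology_class_mem_H2[OF c] by blast
        then obtain l where l: "l \<in> hom A ?C"
          and eq: "cohomology_class G ?C (restrict (l \<circ> \<gamma>) (carrier G \<times> carrier G)) = cohomology_class G ?C c"
          by (auto simp: eta_def)
        then obtain t where t: "t \<in> carrier G \<rightarrow> carrier ?C"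
          "\<And>g h. g \<in> carrier G \<Longrightarrow> h \<in> carrier G \<Longrightarrow> l (\<gamma> (g, h)) = factor_set G ?C t (g, h) \<otimes>\<^bsub>?C\<^esub> c (g, h)"
          using cohomology_class_eq_iff[OF G.group_axioms comm_group_complex_units
              image_cocycle[OF comm_group_complex_units l] c]
          by auto
        show "\<exists>\<Phi>\<in>hom E (crossed_product G ?C c). \<forall>x\<in>carrier E. fst (\<Phi> x) = p x"
          using hom_crossed_product[OF comm_group_complex_units l
              two_cocycle_complex_units[OF G.group_axioms c] t]
          by (intro bexI[rotated]) auto
      qed
    next
      \<comment> \<open>The homomorphism \<Phi> is independent of any section, so it can be combined
        with whichever section defines the given \<gamma>.\<close>
      assume R: ?R
      show ?L
      proof
        fix \<gamma> assume "\<gamma> \<in> extension_cocycles E G p"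
        then obtain s where s: "s \<in> carrier G \<rightarrow> carrier E" "\<And>g. g \<in> carrier G \<Longrightarrow> p (s g) = g"
          and \<gamma>: "\<gamma> = factor_set G E s"
          by (auto simp: extension_cocycles_def)
        interpret sectioned_extension E G p s
          by unfold_locales (use s in auto)
        show "eta G \<gamma> ` hom A ?C = carrier (H2 G ?C)"
        proof (intro equalityI subsetI)
          fix X assume "X \<in> eta G \<gamma> ` hom A ?C"
          then show "X \<in> carrier (H2 G ?C)"
            using image_cocycle[OF comm_group_complex_units] cohomology_class_mem_H2
            by (auto simp: eta_def \<gamma>)
        next
          fix X assume "X \<in> carrier (H2 G ?C)"
          then obtain c where c: "c \<in> carrier (Z2 G ?C)" and X: "X = cohomology_class G ?C c"
            by (rule H2_classE)
          obtain \<Phi> where "\<Phi> \<in> hom E (crossed_product G ?C c)" "\<And>x. x \<in> carrier E \<Longrightarrow> fst (\<Phi> x) = p x"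
            using R c by blast
          then obtain l t where l: "l \<in> hom A ?C" and t: "t \<in> carrier G \<rightarrow> carrier ?C"
            "\<And>g h. g \<in> carrier G \<Longrightarrow> h \<in> carrier G \<Longrightarrow>
              l (factor_set G E s (g, h)) = factor_set G ?C t (g, h) \<otimes>\<^bsub>?C\<^esub> c (g, h)"
            using character_of_hom_crossed_product[OF two_cocycle_complex_units[OF G.group_axioms c]]
            by metis
          have "eta G \<gamma> l = X"
            unfolding eta_def X \<gamma>
            using cohomology_class_eq_iff[OF G.group_axioms comm_group_complex_units
                image_cocycle[OF comm_group_complex_units l] c] t
            by auto
          then show "X \<in> eta G \<gamma> ` hom A ?C" using l by blast
        qed
      qed
    qed
  qed
  then show ?thesis by (auto simp: is_cover_def)
qed

section \<open>Quotients of free products\<close>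

text \<open>The \<open>m\<close>-th power of the lift \<open>(g, 1)\<close> lies over the identity,
  so it is \<open>emb a\<close> for some \<open>a\<close>. Multiplying the lift by an
  \<open>m\<close>-th root of the inverse of \<open>a\<close> makes this power trivial.\<close>

lemma torsion_lift:
  assumes G: "group G" and c: "c \<in> carrier (Z2 G complex_units)"
    and g: "g \<in> carrier G" "g [^]\<^bsub>G\<^esub> m = \<one>\<^bsub>G\<^esub>" and m: "0 < (m::nat)"
  obtains w where "w \<in> carrier (crossed_product G complex_units c)" "fst w = g"
    "w [^]\<^bsub>crossed_product G complex_units c\<^esub> m = \<one>\<^bsub>crossed_product G complex_units c\<^esub>"
proof -
  interpret c: two_cocycle G complex_units c
    by (rule two_cocycle_complex_units[OF G c])
  have g1: "(g, 1) \<in> carrier c.E" using g by simp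
  have "fst ((g, 1::complex) [^]\<^bsub>c.E\<^esub> m) = \<one>\<^bsub>G\<^esub>"
    using hom_nat_pow[OF c.fst_hom g1 c.E.group_axioms G, of m] g by simp
  then obtain a where a: "a \<in> carrier complex_units" "(g, 1) [^]\<^bsub>c.E\<^esub> m = c.emb a"
    using c.embE[OF c.E.nat_pow_closed[OF g1]] by metis
  obtain v where v: "v ^ m = inverse a"
    using exists_complex_root[OF m] by blast
  have vc: "v \<in> carrier complex_units"
    using v a m by (auto simp: power_0_left)
  have v_emb: "c.emb v \<otimes>\<^bsub>c.E\<^esub> (g, 1) = (g, v)"
    using c.emb_mult[OF vc g(1), of 1] by (simp del: crossed_product_simps)
  have "(g, v) [^]\<^bsub>c.E\<^esub> m = c.emb (v ^ m) \<otimes>\<^bsub>c.E\<^esub> c.emb a"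
    using c.pow_emb_mult[OF vc g1, of m] a v_emb by (simp del: crossed_product_simps)
  also have "\<dots> = c.emb (v ^ m * a)"
    using c.emb_hom vc a by (auto simp: hom_def simp del: crossed_product_simps)
  also have "\<dots> = \<one>\<^bsub>c.E\<^esub>"
    using a hom_one[OF c.emb_hom CU.group_axioms c.E.group_axioms] by (simp add: v del: crossed_product_simps)
  finally show thesis
    using that[of "(g, v)"] vc g by simp
qed

lemma generate_Union_cyclic:
  assumes "group F" and f: "\<And>i. i \<in> I \<Longrightarrow> f i \<in> carrier F"
  shows "generate F (\<Union>i\<in>I. generate F {f i}) = generate F (f ` I)"
proof -
  interpret group F by fact
  have fI: "f ` I \<subseteq> carrier F" using f by auto
  show ?thesis
  proof (rule antisym)
    have "generate F {f i} \<subseteq> generate F (f ` I)" if "i \<in> I" for i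
      using that mono_generate[of "{f i}" "f ` I"] by auto
    then show "generate F (\<Union>i\<in>I. generate F {f i}) \<subseteq> generate F (f ` I)"
      by (intro generate_subgroup_incl generate_is_subgroup fI) auto
    show "generate F (f ` I) \<subseteq> generate F (\<Union>i\<in>I. generate F {f i})"
      by (rule mono_generate) (auto intro: generate.incl)
  qed
qed

lemma homs_eq_on_generate:
  assumes "group F" "group G" "\<phi> \<in> hom F G" "\<psi> \<in> hom F G" "X \<subseteq> carrier F"
    and eq: "\<And>x. x \<in> X \<Longrightarrow> \<phi> x = \<psi> x" and x: "x \<in> generate F X"
  shows "\<phi> x = \<psi> x"
proof -
  interpret \<phi>: group_hom F G \<phi> using assms by (simp add: group_hom_def group_hom_axioms_def)
  interpret \<psi>: group_hom F G \<psi> using assms by (simp add: group_hom_def group_hom_axioms_def)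
  show ?thesis
    using x
  proof (induction rule: generate.induct)
    case (inv h)
    then show ?case using eq[of h] assms(5) by (simp add: subset_iff)
  next
    case (eng a b)
    then show ?case using \<phi>.G.generate_in_carrier[OF assms(5)] by simp
  qed (simp_all add: eq)
qed

text \<open>Lifts of the \<open>pr (f i)\<close> killed by the orders of the \<open>f i\<close>
  define homomorphisms on the cyclic factors, which assemble on the free product. The result lies
  over \<open>pr\<close> because it does so on the generators.\<close>

lemma free_product_lift:
  assumes fp: "is_free_product F I (\<lambda>i. generate F {f i})" and G: "group G" and pr: "pr \<in> hom F G"
    and f: "\<And>i. i \<in> I \<Longrightarrow> f i \<in> carrier F" "\<And>i. i \<in> I \<Longrightarrow> 0 < group.ord F (f i)"
    and c: "c \<in> carrier (Z2 G complex_units)"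
  obtains \<Phi> where "\<Phi> \<in> hom F (crossed_product G complex_units c)"
    "\<And>x. x \<in> carrier F \<Longrightarrow> fst (\<Phi> x) = pr x"
proof -
  interpret F: group F using fp by (simp add: is_free_product_def)
  interpret c: two_cocycle G complex_units c
    by (rule two_cocycle_complex_units[OF G c])
  interpret pr: group_hom F G pr
    using pr by (simp add: group_hom_def group_hom_axioms_def F.group_axioms G)
  have "\<exists>w. w \<in> carrier c.E \<and> fst w = pr (f i) \<and> w [^]\<^bsub>c.E\<^esub> F.ord (f i) = \<one>\<^bsub>c.E\<^esub>" if i: "i \<in> I" for i
  proof -
    have "pr (f i) [^]\<^bsub>G\<^esub> F.ord (f i) = \<one>\<^bsub>G\<^esub>"
      using f(1)[OF i] by (simp flip: pr.hom_nat_pow)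
    then show ?thesis
      using torsion_lift[OF G c _ _ f(2)[OF i]] f(1)[OF i] pr.hom_closed by metis
  qed
  then obtain w where w: "\<And>i. i \<in> I \<Longrightarrow> w i \<in> carrier c.E" "\<And>i. i \<in> I \<Longrightarrow> fst (w i) = pr (f i)"
    "\<And>i. i \<in> I \<Longrightarrow> w i [^]\<^bsub>c.E\<^esub> F.ord (f i) = \<one>\<^bsub>c.E\<^esub>"
    by metis
  have "\<exists>\<psi>. \<psi> \<in> hom (F\<lparr>carrier := generate F {f i}\<rparr>) c.E \<and> \<psi> (f i) = w i" if i: "i \<in> I" for i
    using F.hom_from_cyclic[OF c.E.group_axioms f(1)[OF i] w(1)[OF i] w(3)[OF i]] by blast
  then obtain \<psi> where \<psi>: "\<And>i. i \<in> I \<Longrightarrow> \<psi> i \<in> hom (F\<lparr>carrier := generate F {f i}\<rparr>) c.E"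
    "\<And>i. i \<in> I \<Longrightarrow> \<psi> i (f i) = w i"
    by metis
  obtain \<Phi> where \<Phi>: "\<Phi> \<in> hom F c.E" "\<And>i x. i \<in> I \<Longrightarrow> x \<in> generate F {f i} \<Longrightarrow> \<Phi> x = \<psi> i x"
    using free_product_universal[OF fp c.E.group_axioms \<psi>(1)] by blast
  have gen: "generate F (f ` I) = carrier F"
    using generate_Union_cyclic[OF F.group_axioms, of I f] f(1) fp by (simp add: is_free_product_def)
  show thesis
  proof
    show "\<Phi> \<in> hom F c.E" by fact
    fix x assume "x \<in> carrier F"
    then have x: "x \<in> generate F (f ` I)" by (simp add: gen)
    have "(fst \<circ> \<Phi>) x = pr x"
    proof (rule homs_eq_on_generate[OF F.group_axioms G hom_compose[OF \<Phi>(1) c.fst_hom] pr _ _ x])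
      show "f ` I \<subseteq> carrier F" using f by auto
      show "(fst \<circ> \<Phi>) y = pr y" if "y \<in> f ` I" for y
        using that \<Phi>(2) \<psi>(2) w(2) generate.incl[of _ "{_}" F] by fastforce
    qed
    then show "fst (\<Phi> x) = pr x" by simp
  qed
qed

section \<open>Minimality of the exponent\<close>

text \<open>Any \<open>n\<close> killing \<open>E'\<close> kills its quotient \<open>G\<close>;
  hypothesis \<open>ord\<close> then makes it kill the generators of \<open>E\<close>. Comparison
  inside one crossed product carries this over to all of \<open>E\<close>.\<close>

lemma pow_trivial_if_cover_exponent:
  assumes E: "finite_central_extension E G p" and E': "is_cover E' G p'"
    and X: "X \<subseteq> carrier E" "generate E X = carrier E"
    and ord: "\<And>x. x \<in> X \<Longrightarrow> x [^]\<^bsub>E\<^esub> group.ord G (p x) = \<one>\<^bsub>E\<^esub>"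
    and n: "\<And>y. y \<in> carrier E' \<Longrightarrow> y [^]\<^bsub>E'\<^esub> n = \<one>\<^bsub>E'\<^esub>"
    and x: "x \<in> carrier E"
  shows "x [^]\<^bsub>E\<^esub> (n::nat) = \<one>\<^bsub>E\<^esub>"
proof (rule ccontr)
  let ?C = complex_units
  assume x_n: "x [^]\<^bsub>E\<^esub> n \<noteq> \<one>\<^bsub>E\<^esub>"
  interpret central_extension E G p
    using E by (simp add: finite_central_extension_iff)
  interpret E': central_extension E' G p'
    using E' by (simp add: is_cover_iff finite_central_extension_iff)
  obtain s where s: "s \<in> carrier G \<rightarrow> carrier E" "\<And>g. g \<in> carrier G \<Longrightarrow> p (s g) = g"
    using exists_section by blast
  interpret sectioned_extension E G p s
    by unfold_locales (use s in auto)
  have surj': "\<exists>y\<in>carrier E'. p' y = g" if "g \<in> carrier G" for g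
    using E'.epi that unfolding epi_def by auto (metis imageE)
  have G_n: "g [^]\<^bsub>G\<^esub> n = \<one>\<^bsub>G\<^esub>" if g: "g \<in> carrier G" for g
  proof -
    obtain y where y: "y \<in> carrier E'" "p' y = g" using surj'[OF g] by blast
    then show ?thesis using n[OF y(1)] E'.p.hom_nat_pow[OF y(1), of n] by simp
  qed
  define a where "a = x [^]\<^bsub>E\<^esub> n"
  have a: "a \<in> kernel E G p"
    using x G_n by (simp add: a_def kernel_def p.hom_nat_pow)
  have "finite (carrier A)"
    using E finite_subset[of "kernel E G p" "carrier E"]
    by (auto simp: finite_central_extension_def kernel_def)
  then obtain l where l: "l \<in> hom A ?C" "l a \<noteq> 1"
    using character_separates[OF comm_group_kernel, of a] a x_n by (auto simp: a_def)
  define c where "c = restrict (l \<circ> \<gamma>) (carrier G \<times> carrier G)"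
  have cZ: "c \<in> carrier (Z2 G ?C)"
    unfolding c_def by (rule image_cocycle[OF comm_group_complex_units l(1)])
  interpret c: two_cocycle G ?C c
    by (rule two_cocycle_complex_units[OF G.group_axioms cZ])
  \<comment> \<open>Here \<open>c\<close> equals \<open>l \<circ> \<gamma>\<close> itself, so the
    constant cochain one is the right \<open>t\<close>.\<close>
  have one_cochain: "factor_set G ?C (\<lambda>_. 1) (g, h) = 1" if "g \<in> carrier G" "h \<in> carrier G" for g h
    using that CU.inv_one by (simp add: factor_set_def del: CU.inv_one)
  define \<Phi> where "\<Phi> x = (p x, l (x \<otimes>\<^bsub>E\<^esub> inv\<^bsub>E\<^esub> (s (p x))))" for x
  have "(\<lambda>x. (p x, l (x \<otimes>\<^bsub>E\<^esub> inv\<^bsub>E\<^esub> (s (p x))) \<otimes>\<^bsub>?C\<^esub> (\<lambda>_. \<one>\<^bsub>?C\<^esub>) (p x))) \<in> hom E c.E"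
    by (rule hom_crossed_product[OF comm_group_complex_units l(1) c.two_cocycle_axioms])
      (simp_all add: c_def one_cochain)
  then have \<Phi>_hom: "\<Phi> \<in> hom E c.E"
    by (simp add: \<Phi>_def[abs_def])
  interpret \<Phi>: group_hom E c.E \<Phi>
    using \<Phi>_hom by unfold_locales
  \<comment> \<open>The section may be unnormalised, so \<Phi> shifts the argument of
    \<open>l\<close> by the inverse of \<open>s\<close> at the unit. Comparing with the value of
    \<Phi> at the identity cancels this shift.\<close>
  have \<Phi>_kernel: "l b = 1" if b: "b \<in> kernel E G p" and eq: "\<Phi> b = \<one>\<^bsub>c.E\<^esub>" for b
  proof -
    define i where "i = inv\<^bsub>E\<^esub> (s \<one>\<^bsub>G\<^esub>)"
    have i: "i \<in> kernel E G p" by (simp add: i_def kernel_def)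
    have b1: "b \<in> carrier E" "p b = \<one>\<^bsub>G\<^esub>" using b by (auto simp: kernel_def)
    have "\<Phi> b = \<Phi> \<one>\<^bsub>E\<^esub>" using eq \<Phi>.hom_one by simp
    then have "l (b \<otimes>\<^bsub>E\<^esub> i) = l i"
      using b1 by (simp add: \<Phi>_def i_def)
    then have "l b * l i = l i"
      using l_mult[OF comm_group_complex_units l(1) b i] by simp
    then show ?thesis
      using l_closed[OF comm_group_complex_units l(1) i] by simp
  qed
  obtain \<Phi>' where \<Phi>'_hom: "\<Phi>' \<in> hom E' c.E" and fst_\<Phi>': "\<And>y. y \<in> carrier E' \<Longrightarrow> fst (\<Phi>' y) = p' y"
    using E' cZ by (auto simp: is_cover_iff)
  interpret \<Phi>': group_hom E' c.E \<Phi>'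
    using \<Phi>'_hom by unfold_locales
  have \<Phi>'_n: "\<Phi>' y [^]\<^bsub>c.E\<^esub> n = \<one>\<^bsub>c.E\<^esub>" if "y \<in> carrier E'" for y
    using \<Phi>'.hom_nat_pow[OF that, of n] n[OF that] by (simp del: crossed_product_simps)
  \<comment> \<open>The image of \<open>E'\<close> enlarged by the central \<open>n\<close>-th roots
    of unity. The condition \<open>z \<noteq> 0\<close> matters when \<open>n = 0\<close>, where
    \<open>z ^ n = 1\<close> holds for every \<open>z\<close>.\<close>
  define W where "W = {c.emb z \<otimes>\<^bsub>c.E\<^esub> \<Phi>' y | z y. z ^ n = 1 \<and> z \<noteq> 0 \<and> y \<in> carrier E'}"
  have W_n: "w [^]\<^bsub>c.E\<^esub> n = \<one>\<^bsub>c.E\<^esub>" if "w \<in> W" for w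
  proof -
    obtain z y where w: "w = c.emb z \<otimes>\<^bsub>c.E\<^esub> \<Phi>' y" "z ^ n = 1" "z \<noteq> 0" "y \<in> carrier E'"
      using \<open>w \<in> W\<close> by (auto simp: W_def)
    have "w [^]\<^bsub>c.E\<^esub> n = c.emb 1 \<otimes>\<^bsub>c.E\<^esub> \<one>\<^bsub>c.E\<^esub>"
      using w c.pow_emb_mult[of z "\<Phi>' y" n] \<Phi>'.hom_closed[OF w(4)] \<Phi>'_n[OF w(4)]
      by (simp del: crossed_product_simps)
    also have "\<dots> = \<one>\<^bsub>c.E\<^esub>"
      using hom_one[OF c.emb_hom CU.group_axioms c.E.group_axioms] by (simp del: crossed_product_simps)
    finally show ?thesis .
  qed
  have emb_m: "c.emb (z * z') = c.emb z \<otimes>\<^bsub>c.E\<^esub> c.emb z'" if "z \<noteq> 0" "z' \<noteq> 0" for z z'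
    using c.emb_hom that by (auto simp: hom_def simp del: crossed_product_simps)
  have emb_c: "c.emb z \<in> carrier c.E" if "z \<noteq> 0" for z
    using c.emb_closed[of z] that by simp
  have W_mult: "(c.emb z \<otimes>\<^bsub>c.E\<^esub> \<Phi>' y) \<otimes>\<^bsub>c.E\<^esub> (c.emb z' \<otimes>\<^bsub>c.E\<^esub> \<Phi>' y')
      = c.emb (z * z') \<otimes>\<^bsub>c.E\<^esub> \<Phi>' (y \<otimes>\<^bsub>E'\<^esub> y')"
    if zy: "z \<noteq> 0" "z' \<noteq> 0" "y \<in> carrier E'" "y' \<in> carrier E'" for z z' y y'
  proof -
    have "\<Phi>' y \<otimes>\<^bsub>c.E\<^esub> (c.emb z' \<otimes>\<^bsub>c.E\<^esub> \<Phi>' y') = c.emb z' \<otimes>\<^bsub>c.E\<^esub> (\<Phi>' y \<otimes>\<^bsub>c.E\<^esub> \<Phi>' y')"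
      using c.emb_central[of z' "\<Phi>' y"] zy emb_c
      by (simp del: crossed_product_simps flip: c.E.m_assoc)
    then show ?thesis
      using zy emb_c emb_m by (simp add: c.E.m_assoc del: crossed_product_simps)
  qed
  have W_one: "\<one>\<^bsub>c.E\<^esub> = c.emb 1 \<otimes>\<^bsub>c.E\<^esub> \<Phi>' \<one>\<^bsub>E'\<^esub>"
    using hom_one[OF c.emb_hom CU.group_axioms c.E.group_axioms] by (simp del: crossed_product_simps)
  have W: "subgroup W c.E"
  proof (rule c.E.subgroupI)
    show "W \<subseteq> carrier c.E"
      using emb_c by (auto simp: W_def simp del: crossed_product_simps)
    have "c.emb 1 \<otimes>\<^bsub>c.E\<^esub> \<Phi>' \<one>\<^bsub>E'\<^esub> \<in> W"
      unfolding W_def by (intro CollectI exI[of _ 1] exI[of _ "\<one>\<^bsub>E'\<^esub>"]) simp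
    then show "W \<noteq> {}" by blast
    show "inv\<^bsub>c.E\<^esub> w \<in> W" if w: "w \<in> W" for w
    proof -
      obtain z y where zy: "w = c.emb z \<otimes>\<^bsub>c.E\<^esub> \<Phi>' y" "z ^ n = 1" "z \<noteq> 0" "y \<in> carrier E'"
        using w by (auto simp: W_def)
      have "inv\<^bsub>c.E\<^esub> w = c.emb (inverse z) \<otimes>\<^bsub>c.E\<^esub> \<Phi>' (inv\<^bsub>E'\<^esub> y)"
      proof (rule c.E.inv_equality)
        show "c.emb (inverse z) \<otimes>\<^bsub>c.E\<^esub> \<Phi>' (inv\<^bsub>E'\<^esub> y) \<otimes>\<^bsub>c.E\<^esub> w = \<one>\<^bsub>c.E\<^esub>"
          unfolding zy(1) W_one using zy by (subst W_mult) auto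
      qed (use zy emb_c in \<open>auto simp del: crossed_product_simps\<close>)
      then show ?thesis
        using zy(2,3,4) unfolding W_def
        by (intro CollectI exI[of _ "inverse z"] exI[of _ "inv\<^bsub>E'\<^esub> y"]) (simp add: power_inverse)
    qed
    show "v \<otimes>\<^bsub>c.E\<^esub> w \<in> W" if vw: "v \<in> W" "w \<in> W" for v w
    proof -
      obtain z y z' y' where zy: "v = c.emb z \<otimes>\<^bsub>c.E\<^esub> \<Phi>' y" "z ^ n = 1" "z \<noteq> 0" "y \<in> carrier E'"
        "w = c.emb z' \<otimes>\<^bsub>c.E\<^esub> \<Phi>' y'" "z' ^ n = 1" "z' \<noteq> 0" "y' \<in> carrier E'"
        using vw unfolding W_def by blast
      have "v \<otimes>\<^bsub>c.E\<^esub> w = c.emb (z * z') \<otimes>\<^bsub>c.E\<^esub> \<Phi>' (y \<otimes>\<^bsub>E'\<^esub> y')"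
        unfolding zy(1,5) by (rule W_mult[OF zy(3,7,4,8)])
      with zy show ?thesis
        unfolding W_def
        by (intro CollectI exI[of _ "z * z'"] exI[of _ "y \<otimes>\<^bsub>E'\<^esub> y'"])
          (simp add: power_mult_distrib)
    qed
  qed
  \<comment> \<open>The image of a generator and an element of the image of \<open>E'\<close> over
    the same point of \<open>G\<close> differ by \<open>emb z\<close>. Both are killed by
    \<open>n\<close>, which forces \<open>z ^ n = 1\<close>.\<close>
  have \<Phi>_X: "\<Phi> ` X \<subseteq> W"
  proof
    fix w assume "w \<in> \<Phi> ` X"
    then obtain y where y: "y \<in> X" "w = \<Phi> y" by blast
    have yE: "y \<in> carrier E" using y X by blast
    obtain y' where y': "y' \<in> carrier E'" "p' y' = p y"
      using surj' p.hom_closed[OF yE] by blast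
    have "fst w = fst (\<Phi>' y')"
      using y y' fst_\<Phi>' by (simp add: \<Phi>_def)
    then obtain z where z: "z \<in> carrier ?C" "w = c.emb z \<otimes>\<^bsub>c.E\<^esub> \<Phi>' y'"
      using c.emb_translate[OF \<Phi>.hom_closed[OF yE] \<Phi>'.hom_closed[OF y'(1)]] y(2) by metis
    have "G.ord (p y) dvd n"
      using G_n p.hom_closed[OF yE] G.pow_eq_id by blast
    then have "y [^]\<^bsub>E\<^esub> n = \<one>\<^bsub>E\<^esub>"
      using ord[OF y(1)] yE E.pow_eq_id by (meson dvd_trans)
    then have "w [^]\<^bsub>c.E\<^esub> n = \<one>\<^bsub>c.E\<^esub>"
      using \<Phi>.hom_nat_pow[OF yE, of n] y(2) by (simp del: crossed_product_simps)
    then have "c.emb (z ^ n) = \<one>\<^bsub>c.E\<^esub>"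
      using c.pow_emb_mult[OF z(1) \<Phi>'.hom_closed[OF y'(1)], of n] \<Phi>'_n[OF y'(1)] z emb_c[of "z ^ n"]
      by (simp del: crossed_product_simps)
    then have "z ^ n = 1"
      using c.emb_inject[of "z ^ n" 1] z(1) hom_one[OF c.emb_hom CU.group_axioms c.E.group_axioms]
      by (simp del: crossed_product_simps)
    then show "w \<in> W"
      using z y' unfolding W_def by auto
  qed
  have "\<Phi> ` carrier E = generate c.E (\<Phi> ` X)"
    using \<Phi>.generate_img[OF X(1)] X(2) by simp
  also have "\<dots> \<subseteq> W"
    by (rule c.E.generate_subgroup_incl[OF \<Phi>_X W])
  finally have "\<Phi> a = \<one>\<^bsub>c.E\<^esub>"
    using x W_n[of "\<Phi> x"] \<Phi>.hom_nat_pow[OF x, of n] by (auto simp: a_def simp del: crossed_product_simps)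
  then show False
    using \<Phi>_kernel[OF a] l(2) by blast
qed

lemma group_exp_le:
  assumes "group E'" "finite (carrier E')"
    and "\<And>n x. (\<And>y. y \<in> carrier E' \<Longrightarrow> y [^]\<^bsub>E'\<^esub> n = \<one>\<^bsub>E'\<^esub>) \<Longrightarrow> x \<in> carrier E \<Longrightarrow>
      x [^]\<^bsub>E\<^esub> (n::nat) = \<one>\<^bsub>E\<^esub>"
  shows "group_exp E \<le> group_exp E'"
proof -
  interpret E': group E' by fact
  \<comment> \<open>The order is a positive exponent of the finite group, so the least exponent is
    attained.\<close>
  have "0 < order E' \<and> (\<forall>x\<in>carrier E'. x [^]\<^bsub>E'\<^esub> order E' = \<one>\<^bsub>E'\<^esub>)"
    using assms(2) E'.order_gt_0_iff_finite E'.pow_order_eq_1 by blast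
  then have "0 < group_exp E' \<and> (\<forall>x\<in>carrier E'. x [^]\<^bsub>E'\<^esub> group_exp E' = \<one>\<^bsub>E'\<^esub>)"
    unfolding group_exp_def by (rule LeastI)
  then show ?thesis
    unfolding group_exp_def[of E] using assms(3) by (intro Least_le) blast
qed

section \<open>The quotient by the commutator subgroup of \<open>R\<close> and
  \<open>F\<close>\<close>

text \<open>A conjugate of a commutator is the commutator of the conjugates, and normality keeps the
  first entry in \<open>R\<close>. The inclusion holds since a commutator is \<open>h\<close> times
  a conjugate of its inverse.\<close>

lemma commutator_subgroup_normal:
  assumes "group F" "R \<lhd> F"
  shows "commutator_subgroup F R (carrier F) \<lhd> F" "commutator_subgroup F R (carrier F) \<subseteq> R"
proof -
  interpret F: group F by fact
  interpret R: normal R F by fact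
  let ?X = "\<Union>h\<in>R. \<Union>k\<in>carrier F. {h \<otimes>\<^bsub>F\<^esub> k \<otimes>\<^bsub>F\<^esub> inv\<^bsub>F\<^esub> h \<otimes>\<^bsub>F\<^esub> inv\<^bsub>F\<^esub> k}"
  have R: "R \<subseteq> carrier F" by (rule R.subset)
  show "commutator_subgroup F R (carrier F) \<lhd> F"
    unfolding commutator_subgroup_def
  proof (rule F.normal_generateI)
    show "?X \<subseteq> carrier F" using R by auto
    fix x g assume "x \<in> ?X" and g: "g \<in> carrier F"
    then obtain h k where h: "h \<in> R" "h \<in> carrier F" and k: "k \<in> carrier F"
      and x: "x = h \<otimes>\<^bsub>F\<^esub> k \<otimes>\<^bsub>F\<^esub> inv\<^bsub>F\<^esub> h \<otimes>\<^bsub>F\<^esub> inv\<^bsub>F\<^esub> k"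
      using R by auto
    define h' k' where "h' = g \<otimes>\<^bsub>F\<^esub> h \<otimes>\<^bsub>F\<^esub> inv\<^bsub>F\<^esub> g" and "k' = g \<otimes>\<^bsub>F\<^esub> k \<otimes>\<^bsub>F\<^esub> inv\<^bsub>F\<^esub> g"
    have cancel: "inv\<^bsub>F\<^esub> g \<otimes>\<^bsub>F\<^esub> (g \<otimes>\<^bsub>F\<^esub> y) = y" if "y \<in> carrier F" for y
      using g that by (simp flip: F.m_assoc)
    have "g \<otimes>\<^bsub>F\<^esub> x \<otimes>\<^bsub>F\<^esub> inv\<^bsub>F\<^esub> g = h' \<otimes>\<^bsub>F\<^esub> k' \<otimes>\<^bsub>F\<^esub> inv\<^bsub>F\<^esub> h' \<otimes>\<^bsub>F\<^esub> inv\<^bsub>F\<^esub> k'"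
      using g h k by (simp add: x h'_def k'_def F.m_assoc F.inv_mult_group cancel)
    moreover have "h' \<in> R" "k' \<in> carrier F"
      using g h k R.inv_op_closed2 by (auto simp: h'_def k'_def)
    ultimately show "g \<otimes>\<^bsub>F\<^esub> x \<otimes>\<^bsub>F\<^esub> inv\<^bsub>F\<^esub> g \<in> ?X" by blast
  qed
  show "commutator_subgroup F R (carrier F) \<subseteq> R"
    unfolding commutator_subgroup_def
  proof (rule F.generate_subgroup_incl[OF _ R.subgroup_axioms])
    show "?X \<subseteq> R"
    proof clarify
      fix h k assume h: "h \<in> R" and k: "k \<in> carrier F"
      have "h \<otimes>\<^bsub>F\<^esub> (k \<otimes>\<^bsub>F\<^esub> inv\<^bsub>F\<^esub> h \<otimes>\<^bsub>F\<^esub> inv\<^bsub>F\<^esub> k) \<in> R"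
        using h k R.inv_op_closed2 by simp
      then show "h \<otimes>\<^bsub>F\<^esub> k \<otimes>\<^bsub>F\<^esub> inv\<^bsub>F\<^esub> h \<otimes>\<^bsub>F\<^esub> inv\<^bsub>F\<^esub> k \<in> R"
        using h k R by (simp add: F.m_assoc subset_iff)
    qed
  qed
qed

theorem theorem1p1:
  fixes F :: "('a, 'b) monoid_scheme" and G :: "('g, 'h) monoid_scheme"
    and R :: "'a set" and pr :: "'a \<Rightarrow> 'g" and d :: nat and f :: "nat \<Rightarrow> 'a"
  assumes "group F" and "group G" and "finite (carrier G)"
    and "pr \<in> epi F G" and "R = kernel F G pr"
    and "\<forall>i\<in>{1..d}. f i \<in> carrier F \<and> 0 < group.ord F (f i)"
    and "is_free_product F {1..d} (\<lambda>i. generate F {f i})"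
  shows "let N = commutator_subgroup F R (carrier F);
             E = F Mod N;
             p = induced_map pr
         in (\<forall>x\<in>carrier F. p (N #>\<^bsub>F\<^esub> x) = pr x) \<and>
            kernel E G p = (\<lambda>r. N #>\<^bsub>F\<^esub> r) ` R \<and>
            is_cover E G p \<and>
            ((\<forall>i\<in>{1..d}. group.ord G (pr (f i)) = group.ord F (f i)) \<longrightarrow>
             (\<forall>(E' :: ('e, 'c) monoid_scheme) p'. is_cover E' G p' \<longrightarrow>
                group_exp E \<le> group_exp E'))"
proof -
  define N where "N = commutator_subgroup F R (carrier F)"
  define E where "E = F Mod N"
  define p where "p = induced_map pr"
  interpret F: group F by fact
  interpret G: group G by fact
  interpret pr: group_hom F G pr
    using assms by unfold_locales (simp add: epi_def)
  have f: "f i \<in> carrier F" "0 < F.ord (f i)" if "i \<in> {1..d}" for i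
    using assms(6) that by auto
  have R: "R \<lhd> F" using pr.normal_kernel assms(5) by simp
  have Rc: "r \<in> carrier F" "pr r = \<one>\<^bsub>G\<^esub>" if "r \<in> R" for r
    using that assms(5) by (auto simp: kernel_def)
  interpret N: normal N F
    unfolding N_def by (rule commutator_subgroup_normal[OF F.group_axioms R])
  have NR: "N \<subseteq> R"
    unfolding N_def by (rule commutator_subgroup_normal[OF F.group_axioms R])
  interpret E: group E
    unfolding E_def by (rule N.factorgroup_is_group)
  define q where "q x = N #>\<^bsub>F\<^esub> x" for x
  have q_hom: "q \<in> hom F E"
    unfolding q_def[abs_def] E_def by (rule N.r_coset_hom_Mod)
  interpret q: group_hom F E q
    using q_hom by unfold_locales
  have E_carrier: "carrier E = q ` carrier F"
    by (simp add: E_def q_def[abs_def] carrier_FactGroup)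
  have q_one: "q x = \<one>\<^bsub>E\<^esub>" if "x \<in> N" for x
    using that by (simp add: q_def E_def N.rcos_const)
  have pq: "p (q x) = pr x" if x: "x \<in> carrier F" for x
  proof -
    \<comment> \<open>As \<open>N\<close> lies in the kernel \<open>R\<close>, the map
      \<open>pr\<close> is constant on each coset, which is what gives \<open>the_elem\<close> its
      meaning here.\<close>
    have "pr ` q x = {pr x}"
    proof (intro equalityI subsetI)
      fix y assume "y \<in> pr ` q x"
      then obtain r where "r \<in> N" "y = pr (r \<otimes>\<^bsub>F\<^esub> x)" by (auto simp: q_def r_coset_def)
      then show "y \<in> {pr x}" using NR Rc[of r] x by auto
    next
      fix y assume "y \<in> {pr x}"
      then show "y \<in> pr ` q x" using F.rcos_self[OF x N.subgroup_axioms] by (auto simp: q_def)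
    qed
    then show ?thesis by (simp add: p_def induced_map_def)
  qed
  have p_epi: "p \<in> epi E G"
  proof -
    have "p \<in> hom E G"
    proof (rule homI)
      show "p X \<in> carrier G" if "X \<in> carrier E" for X
        using that pq by (auto simp: E_carrier)
      show "p (X \<otimes>\<^bsub>E\<^esub> Y) = p X \<otimes>\<^bsub>G\<^esub> p Y" if "X \<in> carrier E" "Y \<in> carrier E" for X Y
        using that pq by (auto simp: E_carrier simp flip: q.hom_mult)
    qed
    moreover have "p ` carrier E = carrier G"
      using assms(4) pq by (simp add: E_carrier image_image epi_def cong: image_cong)
    ultimately show ?thesis by (simp add: epi_def)
  qed
  have ker: "kernel E G p = q ` R"
  proof (intro equalityI subsetI)
    fix X assume "X \<in> kernel E G p"
    then obtain x where x: "x \<in> carrier F" "X = q x" "p X = \<one>\<^bsub>G\<^esub>"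
      by (auto simp: kernel_def E_carrier)
    then have "x \<in> R" using pq by (simp add: assms(5) kernel_def)
    then show "X \<in> q ` R" using x by blast
  next
    fix X assume "X \<in> q ` R"
    then obtain r where r: "r \<in> R" "X = q r" by blast
    then show "X \<in> kernel E G p" using pq Rc[OF r(1)] by (simp add: kernel_def)
  qed
  have central: "a \<otimes>\<^bsub>E\<^esub> x = x \<otimes>\<^bsub>E\<^esub> a" if ax: "a \<in> kernel E G p" "x \<in> carrier E" for a x
  proof -
    obtain r y where r: "r \<in> R" "a = q r" and y: "y \<in> carrier F" "x = q y"
      using ax by (auto simp: ker E_carrier)
    \<comment> \<open>The commutator \<open>k\<close> lies in \<open>N\<close>, so in the quotient
      \<open>r\<close> and \<open>y\<close> commute.\<close>
    define k where "k = r \<otimes>\<^bsub>F\<^esub> y \<otimes>\<^bsub>F\<^esub> inv\<^bsub>F\<^esub> r \<otimes>\<^bsub>F\<^esub> inv\<^bsub>F\<^esub> y"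
    have "k \<in> N"
      unfolding N_def commutator_subgroup_def k_def using r(1) y(1) by (intro generate.incl) blast
    have kc: "k \<in> carrier F" using r y Rc by (simp add: k_def)
    have "r \<otimes>\<^bsub>F\<^esub> y = k \<otimes>\<^bsub>F\<^esub> (y \<otimes>\<^bsub>F\<^esub> r)"
      using r y Rc by (simp add: k_def F.m_assoc) (simp flip: F.m_assoc)
    then have "q (r \<otimes>\<^bsub>F\<^esub> y) = q (y \<otimes>\<^bsub>F\<^esub> r)"
      using kc r y Rc q_one[OF \<open>k \<in> N\<close>] by simp
    then show ?thesis using r y Rc by simp
  qed
  define X where "X = q ` f ` {1..d}"
  have fc: "f ` {1..d} \<subseteq> carrier F" using f by auto
  have X: "finite X" "X \<subseteq> carrier E" "generate E X = carrier E"
  proof -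
    show "finite X" by (simp add: X_def)
    show "X \<subseteq> carrier E" using fc by (auto simp: X_def E_carrier)
    have "generate F (f ` {1..d}) = carrier F"
      using generate_Union_cyclic[OF F.group_axioms, of "{1..d}" f] f(1) assms(7)
      by (simp add: is_free_product_def)
    then show "generate E X = carrier E"
      using q.generate_img[OF fc] by (simp add: X_def E_carrier)
  qed
  have X_ord: "q (f i) [^]\<^bsub>E\<^esub> F.ord (f i) = \<one>\<^bsub>E\<^esub>" if "i \<in> {1..d}" for i
    using f(1)[OF that] by (simp flip: q.hom_nat_pow)
  interpret CE: central_extension E G p
    using p_epi central by unfold_locales
  have "finite (carrier E)"
  proof (rule finite_central_extension_of_torsion[OF CE.p.group_hom_axioms assms(3) central X])
    show "0 < E.ord x" if x: "x \<in> X" for x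
    proof -
      obtain i where i: "i \<in> {1..d}" "x = q (f i)" using x by (auto simp: X_def)
      \<comment> \<open>The value \<open>0\<close> of \<open>ord\<close> encodes infinite order; it
        is excluded because the positive number \<open>F.ord (f i)\<close> kills
        \<open>x\<close>.\<close>
      then show ?thesis
        using X_ord[OF i(1)] f[OF i(1)] E.pow_eq_id[of x "F.ord (f i)"] by (auto intro: Nat.gr0I)
    qed
  qed
  then have fce: "finite_central_extension E G p"
    by (simp add: finite_central_extension_iff CE.central_extension_axioms)
  have cover: "is_cover E G p"
    unfolding is_cover_iff
  proof (intro conjI fce ballI)
    fix c assume c: "c \<in> carrier (Z2 G complex_units)"
    interpret c: two_cocycle G complex_units c
      by (rule two_cocycle_complex_units[OF assms(2) c])
    obtain \<Psi> where \<Psi>: "\<Psi> \<in> hom F c.E" "\<And>x. x \<in> carrier F \<Longrightarrow> fst (\<Psi> x) = pr x"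
      using free_product_lift[OF assms(7,2) pr.homh f c] by blast
    interpret \<Psi>: group_hom F c.E \<Psi> using \<Psi>(1) by unfold_locales
    \<comment> \<open>For \<open>r\<close> in \<open>R\<close> the image under \<Psi> lies over the
      identity and is therefore central. So \<Psi> kills all generators of \<open>N\<close> and
      factors through \<open>E\<close>.\<close>
    have "N \<subseteq> kernel F c.E \<Psi>"
      unfolding N_def commutator_subgroup_def
    proof (rule F.generate_subgroup_incl[OF _ \<Psi>.subgroup_kernel], clarify)
      fix r y assume r: "r \<in> R" and y: "y \<in> carrier F"
      obtain a where a: "a \<in> carrier complex_units" "\<Psi> r = c.emb a"
        using c.embE[OF \<Psi>.hom_closed] \<Psi>(2) Rc[OF r] by metis
      have "\<Psi> r \<otimes>\<^bsub>c.E\<^esub> \<Psi> y = \<Psi> y \<otimes>\<^bsub>c.E\<^esub> \<Psi> r"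
        using c.emb_central[OF a(1) \<Psi>.hom_closed[OF y]] a(2) by simp
      then have "\<Psi> (r \<otimes>\<^bsub>F\<^esub> y \<otimes>\<^bsub>F\<^esub> inv\<^bsub>F\<^esub> r \<otimes>\<^bsub>F\<^esub> inv\<^bsub>F\<^esub> y)
          = \<Psi> y \<otimes>\<^bsub>c.E\<^esub> \<Psi> r \<otimes>\<^bsub>c.E\<^esub> inv\<^bsub>c.E\<^esub> (\<Psi> r) \<otimes>\<^bsub>c.E\<^esub> inv\<^bsub>c.E\<^esub> (\<Psi> y)"
        using r y Rc by (simp del: crossed_product_simps)
      also have "\<dots> = \<one>\<^bsub>c.E\<^esub>"
        using y \<Psi>.hom_closed[OF y] \<Psi>.hom_closed[OF Rc(1)[OF r]]
        by (simp add: c.E.m_assoc del: crossed_product_simps)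
      finally show "r \<otimes>\<^bsub>F\<^esub> y \<otimes>\<^bsub>F\<^esub> inv\<^bsub>F\<^esub> r \<otimes>\<^bsub>F\<^esub> inv\<^bsub>F\<^esub> y \<in> kernel F c.E \<Psi>"
        using r y Rc by (simp add: kernel_def del: crossed_product_simps)
    qed
    then obtain \<Phi> where \<Phi>: "\<Phi> \<in> hom E c.E" "\<And>x. x \<in> carrier F \<Longrightarrow> \<Phi> (q x) = \<Psi> x"
      using \<Psi>.FactGroup_universal_kernel[OF N.normal_axioms] by (metis E_def q_def)
    show "\<exists>\<Phi>\<in>hom E c.E. \<forall>x\<in>carrier E. fst (\<Phi> x) = p x"
      using \<Phi> \<Psi>(2) pq by (intro bexI[of _ \<Phi>]) (auto simp: E_carrier)
  qed
  have min: "group_exp E \<le> group_exp E'"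
    if ord: "\<forall>i\<in>{1..d}. G.ord (pr (f i)) = F.ord (f i)" and E': "is_cover E' G p'"
    for E' :: "('e, 'c) monoid_scheme" and p'
  proof (rule group_exp_le)
    show "group E'" "finite (carrier E')"
      using E' by (auto simp: is_cover_def finite_central_extension_def)
    \<comment> \<open>By order preservation, the order of \<open>p (q (f i)) = pr (f i)\<close> is
      that of \<open>f i\<close>, which kills the image of \<open>f i\<close> in
      \<open>E\<close>.\<close>
    have "y [^]\<^bsub>E\<^esub> G.ord (p y) = \<one>\<^bsub>E\<^esub>" if y: "y \<in> X" for y
      using y X_ord ord pq f(1) by (auto simp: X_def)
    then show "x [^]\<^bsub>E\<^esub> n = \<one>\<^bsub>E\<^esub>"
      if "\<And>y. y \<in> carrier E' \<Longrightarrow> y [^]\<^bsub>E'\<^esub> n = \<one>\<^bsub>E'\<^esub>" "x \<in> carrier E" for n :: nat and x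
      using pow_trivial_if_cover_exponent[OF fce E' X(2,3)] that by blast
  qed
  show ?thesis
    unfolding Let_def N_def[symmetric] E_def[symmetric] p_def[symmetric] q_def[symmetric]
    using pq ker cover min by (auto simp: q_def[abs_def])
qed

end
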